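(* Let $F$ be a self-similar set in $\mathbb{R}^d$ with Minkowski dimension $D\in(d-1,d)$ satisfying OSC. Assume there exists a strong feasible open set $O$ for $F$ such that $\partial O\subset F$, i.e. such that the generated tiling $\mathcal{T}=\mathcal{T}(O)$ is compatible, and assume in addition that the generator $G$ of $\mathcal{T}(O)$ is monophase. Then $F$ is Minkowski measurable if and only if it is nonlattice.
   Context: Setting. $N\ge2$, $S_1,\dots,S_N:\mathbb{R}^d\to\mathbb{R}^d$ are contracting similarities with ratios $r_i\in(0,1)$ (an IFS), $\mathbf{S}(A):=\bigcup_{i=1}^N S_i(A)$, and the self-similar set $F$ is the unique nonempty compact set with $\mathbf{S}F=F$. The similarity dimension $D$ is the unique real solution of $\sum_{i=1}^N r_i^D=1$; under OSC it equals the Minkowski dimension of $F$. A feasible open set is a nonempty bounded open set $O$ with $S_iO\subset O$ for all $i$ and $S_iO\cap S_jO=\emptyset$ for $i\ne j$; OSC means that one exists; $O$ is strong if $O\cap F\ne\emptyset$. $F$ is nonlattice if the additive subgroup of $\mathbb{R}$ generated by $\ln r_1,\dots,\ln r_N$ is not discrete. Tilings. The generator is the open set $G:=O\setminus\mathbf{S}\overline O$; the self-similar tiling generated on $O$ is $\mathcal{T}(O):=\{S_\sigma G:\sigma\in\bigcup_{n\ge0}\{1,\dots,N\}^n\}$, where $S_\sigma:=S_{\sigma_1}\circ\dots\circ S_{\sigma_n}$ for $\sigma=\sigma_1\cdots\sigma_n$. The tiling is called compatible if $\partial G\subset F$ (equivalently $\partial\overline O\subset F$). The inradius of $G$ is $g:=\sup\{d(x,\partial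 G):x\in G\}$. With $V(G,\varepsilon):=\lambda_d(\{x\in G:d(x,\partial G)\le\varepsilon\})$ ($\lambda_d$ Lebesgue measure), $G$ is monophase if there are real numbers $\kappa_k(G)$ with $V(G,\varepsilon)=\sum_{k=0}^{d-1}\kappa_k(G)\varepsilon^{d-k}$ for $0<\varepsilon\le g$. A bounded set $A\subset\mathbb{R}^d$ is Minkowski measurable if for some $s\ge0$ the limit $\mathcal{M}^s(A)=\lim_{\varepsilon\searrow0}\varepsilon^{s-d}\lambda_d(A_\varepsilon)$ exists and is positive and finite, where $A_\varepsilon:=\{z:\inf_{a\in A}|a-z|\le\varepsilon\}$. *)

theory Defs
  imports "HOL-Analysis.Analysis" "HOL-Computational_Algebra.Group_Closure"
begin

section \<open>Iterated function systems of similarities\<close>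

definition similarity_ifs ::
    "nat \<Rightarrow> (nat \<Rightarrow> 'a::euclidean_space \<Rightarrow> 'a) \<Rightarrow> (nat \<Rightarrow> real) \<Rightarrow> bool" where
  "similarity_ifs N S r \<longleftrightarrow>
     2 \<le> N \<and>
     (\<forall>i\<in>{1..N}. 0 < r i \<and> r i < 1 \<and> (\<forall>x y. dist (S i x) (S i y) = r i * dist x y))"

definition hutchinson :: "nat \<Rightarrow> (nat \<Rightarrow> 'a \<Rightarrow> 'a) \<Rightarrow> 'a set \<Rightarrow> 'a set" where
  "hutchinson N S A = (\<Union>i\<in>{1..N}. S i ` A)"

definition self_similar_set ::
    "nat \<Rightarrow> (nat \<Rightarrow> 'a::euclidean_space \<Rightarrow> 'a) \<Rightarrow> 'a set \<Rightarrow> bool" where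
  "self_similar_set N S F \<longleftrightarrow> F \<noteq> {} \<and> compact F \<and> hutchinson N S F = F"

definition feasible_open_set ::
    "nat \<Rightarrow> (nat \<Rightarrow> 'a::euclidean_space \<Rightarrow> 'a) \<Rightarrow> 'a set \<Rightarrow> bool" where
  "feasible_open_set N S U \<longleftrightarrow>
     U \<noteq> {} \<and> bounded U \<and> open U \<and>
     (\<forall>i\<in>{1..N}. S i ` U \<subseteq> U) \<and>
     (\<forall>i\<in>{1..N}. \<forall>j\<in>{1..N}. i \<noteq> j \<longrightarrow> S i ` U \<inter> S j ` U = {})"

definition open_set_condition ::
    "nat \<Rightarrow> (nat \<Rightarrow> 'a::euclidean_space \<Rightarrow> 'a) \<Rightarrow> bool" where
  "open_set_condition N S \<longleftrightarrow> (\<exists>U. feasible_open_set N S U)"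

definition strong_feasible_open_set ::
    "nat \<Rightarrow> (nat \<Rightarrow> 'a::euclidean_space \<Rightarrow> 'a) \<Rightarrow> 'a set \<Rightarrow> 'a set \<Rightarrow> bool" where
  "strong_feasible_open_set N S F U \<longleftrightarrow> feasible_open_set N S U \<and> U \<inter> F \<noteq> {}"

definition nonlattice :: "nat \<Rightarrow> (nat \<Rightarrow> real) \<Rightarrow> bool" where
  "nonlattice N r \<longleftrightarrow> \<not> discrete (group_closure ((\<lambda>i. ln (r i)) ` {1..N}))"


section \<open>Minkowski content and dimension\<close>

text \<open>Only meant for nonempty \<open>A\<close>, since \<^term>\<open>infdist x {} = 0\<close>.\<close>

definition parallel_set :: "'a::euclidean_space set \<Rightarrow> real \<Rightarrow> 'a set" where
  "parallel_set A \<epsilon> = {z. infdist z A \<le> \<epsilon>}"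

definition has_minkowski_content :: "'a::euclidean_space set \<Rightarrow> real \<Rightarrow> real \<Rightarrow> bool" where
  "has_minkowski_content A s M \<longleftrightarrow>
     ((\<lambda>\<epsilon>. \<epsilon> powr (s - real DIM('a)) * measure lebesgue (parallel_set A \<epsilon>)) \<longlongrightarrow> M)
       (at_right 0)"

definition minkowski_measurable :: "'a::euclidean_space set \<Rightarrow> bool" where
  "minkowski_measurable A \<longleftrightarrow>
     bounded A \<and> (\<exists>s\<ge>0. \<exists>M>0. has_minkowski_content A s M)"

definition has_minkowski_dimension :: "'a::euclidean_space set \<Rightarrow> real \<Rightarrow> bool" where
  "has_minkowski_dimension A D \<longleftrightarrow>
     ((\<lambda>\<epsilon>. real DIM('a) - ln (measure lebesgue (parallel_set A \<epsilon>)) / ln \<epsilon>) \<longlongrightarrow> D)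
       (at_right 0)"


section \<open>Generators of self-similar tilings\<close>

definition generator ::
    "nat \<Rightarrow> (nat \<Rightarrow> 'a::euclidean_space \<Rightarrow> 'a) \<Rightarrow> 'a set \<Rightarrow> 'a set" where
  "generator N S U = U - hutchinson N S (closure U)"

definition compatible_tiling ::
    "nat \<Rightarrow> (nat \<Rightarrow> 'a::euclidean_space \<Rightarrow> 'a) \<Rightarrow> 'a set \<Rightarrow> 'a set \<Rightarrow> bool" where
  "compatible_tiling N S F U \<longleftrightarrow> frontier (generator N S U) \<subseteq> F"

definition inradius :: "'a::euclidean_space set \<Rightarrow> real" where
  "inradius G = (SUP x\<in>G. infdist x (frontier G))"

definition inner_parallel_volume :: "'a::euclidean_space set \<Rightarrow> real \<Rightarrow> real" where
  "inner_parallel_volume G \<epsilon> = measure lebesgue {x\<in>G. infdist x (frontier G) \<le> \<epsilon>}"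

definition monophase :: "'a::euclidean_space set \<Rightarrow> bool" where
  "monophase G \<longleftrightarrow>
     (\<exists>\<kappa> :: nat \<Rightarrow> real. \<forall>\<epsilon>. 0 < \<epsilon> \<and> \<epsilon> \<le> inradius G \<longrightarrow>
        inner_parallel_volume G \<epsilon> = (\<Sum>k<DIM('a). \<kappa> k * \<epsilon> ^ (DIM('a) - k)))"


text \<open>
  For a feasible open set \<open>U\<close>, compatibility of the generated tiling is the same as
  \<^term>\<open>frontier U \<subseteq> F\<close>.
\<close>

lemma compatible_tiling_iff_frontier_subset:
  fixes S :: "nat \<Rightarrow> 'a::euclidean_space \<Rightarrow> 'a"
  assumes ifs: "similarity_ifs N S r" and F: "self_similar_set N S F"
    and U: "feasible_open_set N S U"
  shows "compatible_tiling N S F U \<longleftrightarrow> frontier U \<subseteq> F"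
proof -
  define H where "H = hutchinson N S (closure U)"
  define G where "G = generator N S U"
  have G_eq: "G = U - H" by (simp add: G_def H_def generator_def)
  have r: "0 < r i" "r i < 1" and S: "dist (S i x) (S i y) = r i * dist x y"
    if "i \<in> {1..N}" for i x y
    using ifs that by (auto simp: similarity_ifs_def)
  have cont: "continuous_on A (S i)" if "i \<in> {1..N}" for i A
  proof (rule continuous_on_subset[OF lipschitz_on_continuous_on])
    show "(r i)-lipschitz_on UNIV (S i)"
      using r(1)[OF that] S[OF that] by (intro lipschitz_onI) auto
  qed auto
  have openU: "open U" and bdU: "bounded U"
    and SU: "\<And>i. i \<in> {1..N} \<Longrightarrow> S i ` U \<subseteq> U"
    using U by (auto simp: feasible_open_set_def)
  have SF: "S i ` F \<subseteq> F" if "i \<in> {1..N}" for i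
    using F that unfolding self_similar_set_def hutchinson_def by blast
  have neF: "F \<noteq> {}" and clF: "closed F"
    using F by (auto simp: self_similar_set_def compact_imp_closed)
  have "compact H"
    unfolding H_def hutchinson_def using bdU
    by (intro compact_UN finite_atLeastAtMost compact_continuous_image cont)
      (auto simp: compact_closure)
  then have clH: "closed H" by (rule compact_imp_closed)
  have openG: "open G" using openU clH by (auto simp: G_eq)
  have fU: "frontier U = closure U - U" and fG: "frontier G = closure G - G"
    using openU openG by (simp_all add: frontier_def interior_open)
  have clGU: "closure G \<subseteq> closure U" by (rule closure_mono) (auto simp: G_eq)
  have inj: "inj (S i)" if "i \<in> {1..N}" for i
    using S[OF that] r(1)[OF that] by (intro injI) (metis dist_eq_0_iff mult_eq_0_iff less_irrefl)
  have openSU: "open (S i ` U)" if "i \<in> {1..N}" for i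
    using cont[OF that] openU inj[OF that] inj_on_subset by (blast intro: invariance_of_domain)
  show ?thesis
  proof
    assume sub: "frontier U \<subseteq> F"
    have "x \<in> F" if x: "x \<in> frontier G" for x
    proof (cases "x \<in> U")
      case False
      then show ?thesis using x sub clGU by (auto simp: fU fG)
    next
      case True
      moreover have "x \<notin> G" using x fG by auto
      ultimately have "x \<in> H" by (auto simp: G_eq)
      then obtain i y where i: "i \<in> {1..N}" and y: "y \<in> closure U" "x = S i y"
        by (auto simp: H_def hutchinson_def)
      have "y \<notin> U"
      proof
        assume "y \<in> U"
        then have "x \<in> S i ` U" using y by auto
        moreover have "S i ` U \<inter> G = {}"
          using i closure_subset[of U] unfolding G_eq H_def hutchinson_def by blast
        then have "S i ` U \<inter> closure G = {}"
          using openSU[OF i] open_Int_closure_eq_empty by blast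
        ultimately show False using x by (auto simp: fG)
      qed
      then show ?thesis using y sub SF[OF i] by (auto simp: fU)
    qed
    then show "compatible_tiling N S F U" by (auto simp: compatible_tiling_def G_def)
  next
    assume "compatible_tiling N S F U"
    then have sub: "frontier G \<subseteq> F" by (simp add: compatible_tiling_def G_def)
    define q where "q = Max (r ` {1..N})"
    have N: "{1..N} \<noteq> {}" using ifs by (auto simp: similarity_ifs_def)
    then have "q \<in> r ` {1..N}" unfolding q_def by (intro Max_in) auto
    then have q: "0 \<le> q" "q < 1" using r by (auto intro: less_imp_le)
    have rq: "r i \<le> q" if "i \<in> {1..N}" for i using that by (auto simp: q_def)
    obtain f0 where f0: "f0 \<in> F" using neF by auto
    have "bounded (closure U)" using bdU by (rule bounded_closure)
    then obtain C where C: "\<And>x. x \<in> closure U \<Longrightarrow> dist x f0 \<le> C"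
      unfolding bounded_any_center[where a = f0] by (auto simp: dist_commute)
    have bound: "infdist x F \<le> q ^ n * C" if "x \<in> frontier U" for n x
      using that
    proof (induction n arbitrary: x)
      case 0
      then show ?case using infdist_le2[OF f0 C] by (auto simp: fU)
    next
      case (Suc n)
      have x: "x \<in> closure U" "x \<notin> U" using Suc.prems by (auto simp: fU)
      have "0 \<le> C" using C[OF x(1)] zero_le_dist order_trans by blast
      have "closure U \<subseteq> closure (G \<union> H)" by (rule closure_mono) (auto simp: G_eq)
      then consider "x \<in> closure G" | "x \<in> H" using x clH by (auto simp: closure_Un)
      then show ?case
      proof cases
        case 1
        moreover have "x \<notin> G" using x by (simp add: G_eq)
        ultimately have "x \<in> F" using sub fG by blast
        then show ?thesis using \<open>0 \<le> C\<close> q by simp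
      next
        case 2
        then obtain i y where i: "i \<in> {1..N}" and y: "y \<in> closure U" "x = S i y"
          by (auto simp: H_def hutchinson_def)
        have "y \<in> frontier U" using SU[OF i] x y by (auto simp: fU)
        then have IH: "infdist y F \<le> q ^ n * C" by (rule Suc.IH)
        obtain f where f: "f \<in> F" "infdist y F = dist y f"
          using infdist_attains_inf[OF clF neF] by metis
        have "infdist x F \<le> dist x (S i f)" using SF[OF i] f by (auto intro: infdist_le)
        also have "\<dots> = r i * infdist y F" using S[OF i] y f by simp
        also have "\<dots> \<le> q * (q ^ n * C)"
          using rq[OF i] IH q by (intro mult_mono) (auto simp: infdist_nonneg)
        finally show ?thesis by (simp add: mult.assoc)
      qed
    qed
    have "x \<in> F" if x: "x \<in> frontier U" for x
    proof -
      have "(\<lambda>n. q ^ n * C) \<longlonglongrightarrow> 0 * C"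
        using q by (intro tendsto_mult_right LIMSEQ_power_zero) auto
      then have "infdist x F \<le> 0 * C"
        by (rule LIMSEQ_le_const) (use bound[OF x] in auto)
      then have "infdist x F = 0" using infdist_nonneg[of x F] by simp
      then show ?thesis using in_closed_iff_infdist_zero[OF clF neF] by simp
    qed
    then show "frontier U \<subseteq> F" by blast
  qed
qed

end

theory Submission
  imports Defs "HOL-Computational_Algebra.Polynomial"
begin

text \<open>Write \<open>d\<close> for the dimension of the space, \<open>\<lambda>\<close> for Lebesgue measure, \<open>F\<^sub>\<epsilon>\<close> for the
  \<open>\<epsilon>\<close>-parallel set of \<open>F\<close>, \<open>G\<close> for the generator, and \<open>s\<close> for the similarity dimension,
  \<open>(\<Sum>i. r\<^sub>i powr s) = 1\<close>. The proof rests on an exact renewal equation. As \<open>frontier U \<subseteq> F\<close>, the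
  distance from \<open>F\<close> agrees on \<open>G\<close> with the distance from \<open>frontier G\<close>, and on \<open>S\<^sub>i U\<close> with the
  distance from \<open>S\<^sub>i F\<close>; the generator and these images fill \<open>U\<close> up to the null set \<open>F\<close>. So
  \<open>v \<epsilon> = \<lambda> (F\<^sub>\<epsilon> \<inter> U)\<close> satisfies \<open>v \<epsilon> = V G \<epsilon> + (\<Sum>i. r\<^sub>i ^ d * v (\<epsilon> / r\<^sub>i))\<close>
  (\<open>volume_renewal\<close>), where \<open>V G\<close> is the inner parallel volume of \<open>G\<close>. In terms of
  \<open>\<epsilon> = exp (- t)\<close>, the rescaled volume \<open>w t = \<epsilon> powr (s - d) * v \<epsilon>\<close> is a bounded solution of a
  renewal equation with weights \<open>r\<^sub>i powr s\<close> and steps \<open>- ln r\<^sub>i\<close>.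

  The part of \<open>F\<^sub>\<epsilon>\<close> outside \<open>U\<close> lies in the parallel set of \<open>frontier U\<close>. Because \<open>U\<close> contains a
  small copy of \<open>F\<close>, the frontier is covered by copies of itself under an iterated system with one
  map missing; its parallel volume is therefore of smaller order
  (\<open>frontier_U_parallel_volume\<close>). Hence convergence of \<open>w\<close> is the same as existence of the
  \<open>s\<close>-dimensional Minkowski content (\<open>w_limit_iff_content\<close>). The bounds
  \<open>d - 1 < s < d\<close> and \<open>\<lambda> F = 0\<close> come from the given Minkowski dimension
  (\<open>similarity_dimension_bounds\<close>).

  In the nonlattice case the renewal theorem \<open>renewal_limit\<close> gives a positive limit of \<open>w\<close>. It is
  proved directly: \<open>w\<close> comes close to its upper limit at a large \<open>t\<close> only if it does so at all
  \<open>t - \<sigma>\<close>, where \<open>\<sigma>\<close> is a sum of steps, and these sums are asymptotically dense in the half-line.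
  Since \<open>w\<close> cannot rise quickly, it is close to its upper limit on long intervals; likewise for
  the lower limit. A monotone average of \<open>w\<close> then forces the two limits to coincide.

  In the lattice case, with steps in \<open>h \<int>\<close>, convergence of \<open>w\<close> would determine the sum of the
  source term along every progression of step \<open>h\<close>. For a monophase generator this says that a
  polynomial in \<open>\<epsilon>\<close> with positive constant term is a multiple of \<open>\<epsilon> powr (d - s)\<close> on an interval,
  which is impossible as \<open>0 < d - s < 1\<close> (\<open>lattice_imp_no_limit\<close>).\<close>

section \<open>Subgroups of the real line\<close>

lemma group_closure_uminus_image:
  fixes T :: "real set"
  shows "group_closure (uminus ` T) = group_closure T"
proof -
  have sub: "group_closure (uminus ` A) \<subseteq> group_closure A" for A :: "real set"
  proof
    fix x assume "x \<in> group_closure (uminus ` A)"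
    then show "x \<in> group_closure A"
    proof induction
      case (base s)
      then show ?case by (auto intro: group_closure.base)
    next
      case (diff s t)
      then show ?case by (auto intro: group_closure.diff)
    qed
  qed
  from sub[of T] sub[of "uminus ` T"] show ?thesis by (simp add: image_image)
qed

lemma nondiscrete_group_has_small_element:
  fixes T :: "real set"
  assumes "\<not> discrete (group_closure T)" and "0 < \<eta>"
  obtains x where "x \<in> group_closure T" "0 < x" "x < \<eta>"
proof -
  have "\<exists>x \<in> group_closure T. 0 < x \<and> x < \<eta>"
  proof (rule ccontr)
    assume no: "\<not> ?thesis"
    have "x isolated_in group_closure T" if x: "x \<in> group_closure T" for x
      unfolding isolated_in_dist_Ex_iff
    proof (intro conjI exI[of _ \<eta>] ballI impI)
      fix y assume y: "y \<in> group_closure T" and d: "dist x y < \<eta>"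
      show "y = x"
      proof (rule ccontr)
        assume "y \<noteq> x"
        then have "x - y > 0 \<and> x - y < \<eta> \<or> y - x > 0 \<and> y - x < \<eta>"
          using d by (auto simp: dist_real_def)
        then show False
          using no x y by (meson group_closure.diff)
      qed
    qed (use x assms in auto)
    then show False using assms by (auto simp: discrete_def)
  qed
  with that show ?thesis by blast
qed

lemma discrete_group_subset_multiples:
  fixes T :: "real set"
  assumes disc: "discrete (group_closure T)" and t0: "t\<^sub>0 \<in> T" "t\<^sub>0 \<noteq> 0"
  obtains h where "0 < h" "\<And>t. t \<in> T \<Longrightarrow> \<exists>k::int. t = of_int k * h"
proof -
  define H where "H = group_closure T"
  have "0 isolated_in H" using disc by (auto simp: discrete_def H_def)
  then obtain e where e: "e > 0" "\<And>y. y \<in> H \<Longrightarrow> \<bar>y\<bar> < e \<Longrightarrow> y = 0"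
    by (auto simp: isolated_in_dist_Ex_iff)
  have Hd: "x - y \<in> H" if "x \<in> H" "y \<in> H" for x y
    using that by (auto simp: H_def intro: group_closure.diff)
  have Hm: "of_int k * x \<in> H" if "x \<in> H" for k x
  proof -
    have n: "of_nat n * x \<in> H" for n
      using that unfolding H_def by (rule group_closure_scalar_mult_left)
    show ?thesis
    proof (cases "k \<ge> 0")
      case True
      then show ?thesis using n[of "nat k"] by simp
    next
      case False
      then have "- (of_int k * x) \<in> H" using n[of "nat (-k)"] by simp
      then show ?thesis unfolding H_def by simp
    qed
  qed
  define P where "P = {x \<in> H. 0 < x}"
  have "t\<^sub>0 \<in> H" "- t\<^sub>0 \<in> H" using t0 by (auto simp: H_def intro: group_closure.base)
  then have "\<bar>t\<^sub>0\<bar> \<in> P" using t0 by (auto simp: P_def abs_if)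
  then have neP: "P \<noteq> {}" by auto
  have bb: "bdd_below P" by (auto simp: P_def intro!: bdd_belowI[of _ 0])
  define h where "h = Inf P"
  \<comment> \<open>The infimum is attained: two distinct elements within \<open>e\<close> of it would differ by less than \<open>e\<close>.\<close>
  obtain x where x: "x \<in> P" "x < h + e"
    using cInf_lessD[OF neP, of "h + e"] e by (auto simp: h_def)
  have hx: "h \<le> x" unfolding h_def using x bb by (intro cInf_lower)
  have "h = x"
  proof (rule ccontr)
    assume "h \<noteq> x"
    then have "h < x" using hx by simp
    then obtain y where y: "y \<in> P" "y < x"
      using cInf_lessD[OF neP, of x] by (auto simp: h_def)
    have "h \<le> y" unfolding h_def using y bb by (intro cInf_lower)
    then have "\<bar>x - y\<bar> < e" using y x by auto
    then have "x - y = 0" using e(2)[of "x - y"] Hd x y by (auto simp: P_def)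
    then show False using y by simp
  qed
  then have h: "h \<in> H" "0 < h" using x by (auto simp: P_def)
  have "\<exists>k::int. t = of_int k * h" if "t \<in> T" for t
  proof -
    define k where "k = \<lfloor>t / h\<rfloor>"
    define y where "y = t - of_int k * h"
    have "t \<in> H" using that by (auto simp: H_def intro: group_closure.base)
    then have yH: "y \<in> H" unfolding y_def using Hd Hm h by blast
    have "of_int k \<le> t / h" "t / h < of_int k + 1" by (auto simp: k_def)
    then have y: "0 \<le> y" "y < h" using h by (auto simp: y_def field_simps)
    have "y = 0"
    proof (rule ccontr)
      assume "y \<noteq> 0"
      then have "y \<in> P" using y yH by (auto simp: P_def)
      then have "h \<le> y" unfolding h_def using bb by (intro cInf_lower)
      then show False using y by simp
    qed
    then show ?thesis by (auto simp: y_def)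
  qed
  with that h show ?thesis by blast
qed

section \<open>Semigroups of positive reals\<close>

inductive_set finite_sums :: "real set \<Rightarrow> real set" for T where
  zero: "0 \<in> finite_sums T"
| add: "t \<in> T \<Longrightarrow> \<sigma> \<in> finite_sums T \<Longrightarrow> \<sigma> + t \<in> finite_sums T"

lemma finite_sums_plus:
  assumes "x \<in> finite_sums T" "y \<in> finite_sums T"
  shows "x + y \<in> finite_sums T"
  using assms(2,1)
  by induction (auto simp: add.assoc[symmetric] intro: finite_sums.intros)

lemma finite_sums_scale: "x \<in> finite_sums T \<Longrightarrow> real n * x \<in> finite_sums T"
  by (induction n) (auto simp: algebra_simps intro: finite_sums.zero finite_sums_plus)

lemma finite_sums_nonneg: "x \<in> finite_sums T \<Longrightarrow> T \<subseteq> {0..} \<Longrightarrow> 0 \<le> x"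
  by (induction rule: finite_sums.induct) auto

lemma group_closure_eq_differences:
  assumes "x \<in> group_closure T"
  shows "\<exists>a\<in>finite_sums T. \<exists>b\<in>finite_sums T. x = a - b"
  using assms
proof induction
  case (base s)
  then show ?case
  proof (cases "s = 0")
    case True
    then show ?thesis by (auto intro!: bexI[of _ 0] finite_sums.zero)
  next
    case False
    then have "s \<in> T" using base by auto
    then have "0 + s \<in> finite_sums T" by (intro finite_sums.intros)
    then show ?thesis by (intro bexI[of _ s] bexI[of _ 0]) (auto intro: finite_sums.zero)
  qed
next
  case (diff s t)
  then obtain a b c d where "a \<in> finite_sums T" "b \<in> finite_sums T" "s = a - b"
    "c \<in> finite_sums T" "d \<in> finite_sums T" "t = c - d" by blast
  then show ?case
    by (intro bexI[of _ "a + d"] bexI[of _ "b + c"]) (auto intro: finite_sums_plus)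
qed

text \<open>If the group has an element \<open>\<delta> = a - b\<close> with \<open>a\<close>, \<open>b\<close> in the semigroup and
  \<open>0 < \<delta> < \<eta>\<close>, then the sums of \<open>n\<close> terms, each \<open>a\<close> or \<open>b\<close>, form an arithmetic progression with
  step \<open>\<delta>\<close> from \<open>n b\<close> to \<open>n a\<close>. Once \<open>n \<delta> \<ge> b\<close>, these progressions overlap and leave no gap
  longer than \<open>\<eta>\<close>.\<close>

lemma finite_sums_eventually_dense:
  assumes T: "T \<subseteq> {0..}" and nd: "\<not> discrete (group_closure T)" and \<eta>: "0 < \<eta>"
  shows "\<exists>L. \<forall>x\<ge>L. \<exists>\<sigma>\<in>finite_sums T. x \<le> \<sigma> \<and> \<sigma> \<le> x + \<eta>"
proof -
  obtain \<delta> where \<delta>: "\<delta> \<in> group_closure T" "0 < \<delta>" "\<delta> < \<eta>"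
    using nondiscrete_group_has_small_element[OF nd \<eta>] by blast
  obtain a b where a: "a \<in> finite_sums T" and b: "b \<in> finite_sums T" and ab: "\<delta> = a - b"
    using group_closure_eq_differences[OF \<delta>(1)] by blast
  have "0 \<le> b" using finite_sums_nonneg[OF b T] .
  show ?thesis
  proof (cases "b = 0")
    case True
    have "\<exists>\<sigma>\<in>finite_sums T. x \<le> \<sigma> \<and> \<sigma> \<le> x + \<eta>" if "x \<ge> 0" for x
    proof (intro bexI conjI)
      define k where "k = nat \<lceil>x / \<delta>\<rceil>"
      have "real k = of_int \<lceil>x / \<delta>\<rceil>" using that \<delta> by (simp add: k_def)
      then have "x / \<delta> \<le> real k" "real k < x / \<delta> + 1" by linarith+
      then show "x \<le> real k * a" "real k * a \<le> x + \<eta>"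
        using \<delta> ab True by (auto simp: field_simps)
      show "real k * a \<in> finite_sums T" using a by (rule finite_sums_scale)
    qed
    then show ?thesis by blast
  next
    case False
    then have bp: "0 < b" using \<open>0 \<le> b\<close> by simp
    define n\<^sub>0 where "n\<^sub>0 = nat \<lceil>b / \<delta>\<rceil>"
    have "b / \<delta> \<le> real n\<^sub>0" unfolding n\<^sub>0_def by linarith
    then have n0: "b \<le> real n\<^sub>0 * \<delta>" using \<delta> by (simp add: field_simps)
    have "\<exists>\<sigma>\<in>finite_sums T. x \<le> \<sigma> \<and> \<sigma> \<le> x + \<eta>" if x: "x \<ge> real n\<^sub>0 * b" for x
    proof -
      have "0 \<le> x" using x bp by (meson mult_nonneg_nonneg of_nat_0_le_iff order_trans less_imp_le)
      define n where "n = nat \<lfloor>x / b\<rfloor>"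
      have rn: "real n = of_int \<lfloor>x / b\<rfloor>" using \<open>0 \<le> x\<close> bp by (simp add: n_def)
      then have nx: "real n \<le> x / b" "x / b < real n + 1" by linarith+
      have "real n\<^sub>0 \<le> x / b" using x bp by (simp add: field_simps)
      then have "n\<^sub>0 \<le> n" unfolding n_def by (simp add: le_nat_floor)
      then have "real n\<^sub>0 * \<delta> \<le> real n * \<delta>" using \<delta> by simp
      then have bn: "b \<le> real n * \<delta>" using n0 by simp
      define k where "k = nat \<lceil>(x - real n * b) / \<delta>\<rceil>"
      have ge: "0 \<le> x - real n * b" using nx bp by (simp add: field_simps)
      have lt: "x - real n * b \<le> real n * \<delta>"
        using nx bp bn by (simp add: field_simps)
      have "real k = of_int \<lceil>(x - real n * b) / \<delta>\<rceil>" using ge \<delta> by (simp add: k_def)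
      then have k: "(x - real n * b) / \<delta> \<le> real k" "real k < (x - real n * b) / \<delta> + 1"
        by linarith+
      have "(x - real n * b) / \<delta> \<le> real n" using lt \<delta> by (simp add: field_simps)
      then have kn: "k \<le> n" unfolding k_def by (simp add: nat_le_iff ceiling_le_iff)
      define \<sigma> where "\<sigma> = real (n - k) * b + real k * a"
      have "\<sigma> = real n * b + real k * \<delta>" using kn by (simp add: \<sigma>_def ab of_nat_diff algebra_simps)
      moreover have "x - real n * b \<le> real k * \<delta>" "real k * \<delta> < x - real n * b + \<delta>"
        using k \<delta> by (auto simp: field_simps)
      ultimately have "x \<le> \<sigma>" "\<sigma> \<le> x + \<eta>" using \<delta> by auto
      moreover have "\<sigma> \<in> finite_sums T"
        unfolding \<sigma>_def using a b by (intro finite_sums_plus finite_sums_scale)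
      ultimately show ?thesis by blast
    qed
    then show ?thesis by blast
  qed
qed

section \<open>A renewal theorem\<close>

text \<open>Up to a vanishing source, \<open>w t\<close> is the average of the \<open>w (t - \<tau> i)\<close> with positive weights, none
  of which exceeds the upper limit \<open>M\<close> by much. So if \<open>w t\<close> is close to \<open>M\<close>, each of them must be
  close to \<open>M\<close>; this iterates to all finite sums of the \<open>\<tau> i\<close>.\<close>

lemma limsup_along_translates:
  fixes w :: "real \<Rightarrow> real" and p \<tau> :: "'i \<Rightarrow> real"
  assumes bdd: "\<And>t. \<bar>w t\<bar> \<le> B"
    and I: "finite I" and p: "\<And>i. i \<in> I \<Longrightarrow> 0 < p i" "(\<Sum>i\<in>I. p i) = 1"
    and z: "((\<lambda>t. w t - (\<Sum>i\<in>I. p i * w (t - \<tau> i))) \<longlongrightarrow> 0) at_top"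
  obtains M and f :: "nat \<Rightarrow> real" where
    "\<And>e. 0 < e \<Longrightarrow> \<forall>\<^sub>F t in at_top. w t \<le> M + e"
    "filterlim f at_top sequentially"
    "\<And>\<sigma>. \<sigma> \<in> finite_sums (\<tau> ` I) \<Longrightarrow> (\<lambda>n. w (f n - \<sigma>)) \<longlonglongrightarrow> M"
proof -
  define A where "A = {m. \<forall>\<^sub>F t in at_top. w t \<le> m}"
  have BA: "B \<in> A" using abs_le_D1[OF bdd] by (simp add: A_def)
  have lbA: "- B \<le> m" if "m \<in> A" for m
  proof -
    have "\<forall>\<^sub>F t in at_top. w t \<le> m" using that by (simp add: A_def)
    then obtain t where "w t \<le> m"
      using eventually_happens'[OF trivial_limit_at_top_linorder] by blast
    then show ?thesis using bdd[of t] by linarith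
  qed
  then have bb: "bdd_below A" by (auto intro!: bdd_belowI)
  define M where "M = Inf A"
  have up: "\<forall>\<^sub>F t in at_top. w t \<le> M + e" if "0 < e" for e
  proof -
    have "A \<noteq> {}" "Inf A < M + e" using BA that by (auto simp: M_def)
    then obtain m where m: "m \<in> A" "m < M + e" by (metis cInf_lessD)
    then have "\<forall>\<^sub>F t in at_top. w t \<le> m" by (simp add: A_def)
    then show ?thesis by eventually_elim (use m in linarith)
  qed
  have "\<exists>t\<ge>real n. w t > M - 1 / (real n + 1)" for n
  proof (rule ccontr)
    assume "\<not> ?thesis"
    then have "\<forall>\<^sub>F t in at_top. w t \<le> M - 1 / (real n + 1)"
      unfolding eventually_at_top_linorder by (intro exI[of _ "real n"]) (auto simp: not_less)
    then have "M - 1 / (real n + 1) \<in> A" by (simp add: A_def)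
    then have "M \<le> M - 1 / (real n + 1)" unfolding M_def by (intro cInf_lower bb)
    moreover have "1 / (real n + 1) > 0" by simp
    ultimately show False by linarith
  qed
  then obtain f where f: "\<And>n. real n \<le> f n" "\<And>n. w (f n) > M - 1 / (real n + 1)" by metis
  have ftop: "filterlim f at_top sequentially"
    by (rule filterlim_at_top_mono[OF filterlim_real_sequentially]) (use f in auto)
  have base: "(\<lambda>n. w (f n)) \<longlonglongrightarrow> M"
  proof (rule order_tendstoI)
    fix a assume "a > M"
    then have "\<forall>\<^sub>F n in sequentially. w (f n) \<le> M + (a - M) / 2"
      using up[of "(a - M) / 2"] by (intro eventually_compose_filterlim[OF _ ftop]) auto
    then show "\<forall>\<^sub>F n in sequentially. w (f n) < a"
      by eventually_elim (use \<open>a > M\<close> in \<open>simp add: field_simps\<close>)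
  next
    fix a assume "a < M"
    have "(\<lambda>n. M - inverse (real (Suc n))) \<longlonglongrightarrow> M - 0"
      by (intro tendsto_intros LIMSEQ_inverse_real_of_nat)
    then have "\<forall>\<^sub>F n in sequentially. a < M - inverse (real (Suc n))"
      using \<open>a < M\<close> by (intro order_tendstoD(1)) auto
    then show "\<forall>\<^sub>F n in sequentially. a < w (f n)"
    proof eventually_elim
      case (elim n)
      then show ?case using f(2)[of n] by (simp add: inverse_eq_divide add.commute)
    qed
  qed
  have step: "(\<lambda>n. w (g n - \<tau> i)) \<longlonglongrightarrow> M"
    if gtop: "filterlim g at_top sequentially" and gM: "(\<lambda>n. w (g n)) \<longlonglongrightarrow> M" and i: "i \<in> I"
    for g :: "nat \<Rightarrow> real" and i
  proof (rule order_tendstoI)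
    have shift: "filterlim (\<lambda>n. g n - c) at_top sequentially" for c
      using filterlim_tendsto_add_at_top[OF tendsto_const[of "-c"] gtop] by simp
    {
      fix a assume "a > M"
      then have "\<forall>\<^sub>F n in sequentially. w (g n - \<tau> i) \<le> M + (a - M) / 2"
        using up[of "(a - M) / 2"] by (intro eventually_compose_filterlim[OF _ shift]) auto
      then show "\<forall>\<^sub>F n in sequentially. w (g n - \<tau> i) < a"
        by eventually_elim (use \<open>a > M\<close> in \<open>simp add: field_simps\<close>)
    }
    fix a assume "a < M"
    \<comment> \<open>If the term with index \<open>i\<close> is at most \<open>a\<close>, the average falls short of \<open>M\<close> by \<open>p i * (M - a)\<close>,
      up to three errors of size \<open>e\<close>: one each for \<open>w (g n)\<close>, the source and the other terms.\<close>
    define e where "e = p i * (M - a) / 4"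
    have e: "0 < e" using \<open>a < M\<close> p i by (simp add: e_def)
    have "\<forall>\<^sub>F n in sequentially. \<forall>j\<in>I. w (g n - \<tau> j) \<le> M + e"
      using I up[OF e] shift
      by (intro eventually_ball_finite) (auto intro: eventually_compose_filterlim)
    moreover have "\<forall>\<^sub>F n in sequentially. w (g n) - (\<Sum>j\<in>I. p j * w (g n - \<tau> j)) < e"
      using order_tendstoD(2)[OF z e] by (rule eventually_compose_filterlim[OF _ gtop])
    moreover have "\<forall>\<^sub>F n in sequentially. w (g n) > M - e"
      using gM e by (intro order_tendstoD(1)) auto
    ultimately show "\<forall>\<^sub>F n in sequentially. a < w (g n - \<tau> i)"
    proof eventually_elim
      case (elim n)
      have "(\<Sum>j\<in>I-{i}. p j * w (g n - \<tau> j)) \<le> (\<Sum>j\<in>I-{i}. p j * (M + e))"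
        using elim(1) p(1) by (intro sum_mono mult_left_mono) (auto intro: less_imp_le)
      also have "\<dots> = (1 - p i) * (M + e)"
        using p(2) I i by (simp add: sum_distrib_right[symmetric] sum_diff1)
      finally have "(\<Sum>j\<in>I. p j * w (g n - \<tau> j)) \<le> p i * w (g n - \<tau> i) + (1 - p i) * (M + e)"
        using I i by (simp add: sum.remove)
      then have "M - e - e < p i * w (g n - \<tau> i) + (1 - p i) * (M + e)"
        using elim by linarith
      then have "p i * M - 3 * e + p i * e < p i * w (g n - \<tau> i)"
        by (simp add: algebra_simps)
      moreover have "0 < p i * e" using e p i by simp
      ultimately have "p i * M - 4 * e < p i * w (g n - \<tau> i)" using e by linarith
      moreover have "4 * e = p i * M - p i * a" by (simp add: e_def field_simps)
      ultimately have "p i * a < p i * w (g n - \<tau> i)" by linarith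
      then show ?case using p i by simp
    qed
  qed
  have "(\<lambda>n. w (f n - \<sigma>)) \<longlonglongrightarrow> M" if "\<sigma> \<in> finite_sums (\<tau> ` I)" for \<sigma>
    using that
  proof induction
    case zero
    then show ?case using base by simp
  next
    case (add t \<sigma>)
    then obtain i where i: "i \<in> I" "t = \<tau> i" by auto
    have "filterlim (\<lambda>n. f n - \<sigma>) at_top sequentially"
      using filterlim_tendsto_add_at_top[OF tendsto_const[of "-\<sigma>"] ftop] by simp
    from step[OF this add.IH i(1)] show ?case using i by (simp add: algebra_simps)
  qed
  with up ftop that show ?thesis by blast
qed

text \<open>A window of length \<open>K\<close> involves only finitely many grid points \<open>\<sigma>\<close> of the semigroup, so
  convergence at each of them is uniform on the window.\<close>

lemma near_limsup_on_long_windows: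
  fixes w :: "real \<Rightarrow> real" and f :: "nat \<Rightarrow> real"
  assumes T: "T \<subseteq> {0..}" and nd: "\<not> discrete (group_closure T)"
    and lim: "\<And>\<sigma>. \<sigma> \<in> finite_sums T \<Longrightarrow> (\<lambda>n. w (f n - \<sigma>)) \<longlonglongrightarrow> M"
    and \<eta>: "0 < \<eta>" and K: "0 \<le> K"
  obtains L where "\<forall>\<^sub>F n in sequentially.
    \<forall>x\<in>{f n - L - K..f n - L}. \<exists>y\<in>{x..x + \<eta>}. \<bar>w y - M\<bar> < \<eta>"
proof -
  obtain L\<^sub>0 where L0: "\<And>x. x \<ge> L\<^sub>0 \<Longrightarrow> \<exists>\<sigma>\<in>finite_sums T. x \<le> \<sigma> \<and> \<sigma> \<le> x + \<eta> / 2"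
    using finite_sums_eventually_dense[OF T nd, of "\<eta> / 2"] \<eta> by auto
  have "\<exists>\<sigma>\<in>finite_sums T. L\<^sub>0 + real k * (\<eta> / 2) \<le> \<sigma> \<and> \<sigma> \<le> L\<^sub>0 + real k * (\<eta> / 2) + \<eta> / 2" for k
    using \<eta> by (intro L0) simp
  then obtain \<sigma> where \<sigma>: "\<And>k. \<sigma> k \<in> finite_sums T" "\<And>k. L\<^sub>0 + real k * (\<eta> / 2) \<le> \<sigma> k"
    "\<And>k. \<sigma> k \<le> L\<^sub>0 + real k * (\<eta> / 2) + \<eta> / 2"
    by metis
  define m where "m = nat \<lceil>2 * (K + \<eta>) / \<eta>\<rceil>"
  have ev: "\<forall>\<^sub>F n in sequentially. \<forall>k\<in>{..m}. \<bar>w (f n - \<sigma> k) - M\<bar> < \<eta>"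
    using lim[OF \<sigma>(1)] \<eta>
    by (intro eventually_ball_finite) (auto simp: tendsto_iff dist_real_def)
  have "\<forall>\<^sub>F n in sequentially. \<forall>x\<in>{f n - (L\<^sub>0 + \<eta>) - K..f n - (L\<^sub>0 + \<eta>)}.
    \<exists>y\<in>{x..x + \<eta>}. \<bar>w y - M\<bar> < \<eta>"
    using ev
  proof eventually_elim
    case (elim n)
    show ?case
    proof
      fix x assume x: "x \<in> {f n - (L\<^sub>0 + \<eta>) - K..f n - (L\<^sub>0 + \<eta>)}"
      define v where "v = f n - x - L\<^sub>0"
      have v: "\<eta> \<le> v" "v \<le> K + \<eta>" using x by (auto simp: v_def)
      \<comment> \<open>Grid point \<open>k\<close> lies within \<open>\<eta> / 2\<close> above its nominal position; backing off by one cell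
        keeps it at most \<open>f n - x\<close>.\<close>
      define k where "k = nat (\<lfloor>2 * v / \<eta>\<rfloor> - 1)"
      have "2 \<le> 2 * v / \<eta>" using v \<eta> by (simp add: field_simps)
      then have "2 \<le> \<lfloor>2 * v / \<eta>\<rfloor>" by linarith
      then have rk: "real k = of_int \<lfloor>2 * v / \<eta>\<rfloor> - 1" by (simp add: k_def)
      then have k: "real k \<le> 2 * v / \<eta> - 1" "2 * v / \<eta> - 2 < real k" by linarith+
      have "2 * v / \<eta> \<le> 2 * (K + \<eta>) / \<eta>" using v \<eta> by (simp add: field_simps)
      then have "k \<le> m" using k(1) unfolding m_def by linarith
      then have "\<bar>w (f n - \<sigma> k) - M\<bar> < \<eta>" using elim by auto
      moreover have "real k * (\<eta> / 2) \<le> v - \<eta> / 2" "v - \<eta> < real k * (\<eta> / 2)"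
        using k \<eta> by (auto simp: field_simps)
      then have "x \<le> f n - \<sigma> k" "f n - \<sigma> k \<le> x + \<eta>"
        using \<sigma>(2,3)[of k] by (auto simp: v_def)
      ultimately show "\<exists>y\<in>{x..x + \<eta>}. \<bar>w y - M\<bar> < \<eta>" by auto
    qed
  qed
  with that show ?thesis by blast
qed

lemma slowly_decreasing_integrable:
  fixes w :: "real \<Rightarrow> real"
  assumes slow: "\<And>x y. x \<le> y \<Longrightarrow> w y \<le> exp (a * (y - x)) * w x"
    and bdd: "\<And>t. \<bar>w t\<bar> \<le> B"
  shows "w integrable_on {x..y}"
proof (rule measurable_bounded_by_integrable_imp_integrable)
  have "mono (\<lambda>t. - (exp (- a * t) * w t))"
  proof (rule monoI)
    fix s t :: real assume "s \<le> t"
    have "exp (- a * t) * w t \<le> exp (- a * t) * (exp (a * (t - s)) * w s)"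
      using slow[OF \<open>s \<le> t\<close>] by (intro mult_left_mono) auto
    also have "\<dots> = exp (- a * s) * w s"
      by (simp add: mult.assoc[symmetric] exp_add[symmetric] algebra_simps)
    finally show "- (exp (- a * s) * w s) \<le> - (exp (- a * t) * w t)" by simp
  qed
  then have "(\<lambda>t. - (exp (- a * t) * w t)) \<in> borel_measurable borel" by (rule borel_measurable_mono)
  moreover have "(\<lambda>t. - exp (a * t)) \<in> borel_measurable borel"
    by (intro borel_measurable_continuous_onI continuous_intros)
  ultimately have "(\<lambda>t. - exp (a * t) * - (exp (- a * t) * w t)) \<in> borel_measurable borel"
    by (intro borel_measurable_times)
  also have "(\<lambda>t. - exp (a * t) * - (exp (- a * t) * w t)) = w"
  proof
    fix t
    have "exp (a * t) * exp (- a * t) = 1" by (simp add: exp_minus)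
    then show "- exp (a * t) * - (exp (- a * t) * w t) = w t"
      by (metis minus_mult_minus mult.assoc mult_1)
  qed
  finally have "w \<in> borel_measurable borel" .
  then have "w \<in> borel_measurable lborel" by (simp only: measurable_lborel2)
  then have "w \<in> borel_measurable lebesgue" by (rule measurable_completion)
  then show "w \<in> borel_measurable (lebesgue_on {x..y})" by (rule measurable_restrict_space1)
  show "(\<lambda>_. B) integrable_on {x..y}" by (rule integrable_const_ivl)
qed (use bdd in auto)

text \<open>A renewal theorem for step laws with finitely many atoms. Over an interval, the quantity
  \<open>\<Phi> t = (\<Sum>i. p\<^sub>i * \<integral>\<^bsub>t - \<tau>\<^sub>i\<^esub>\<^bsup>t\<^esup> w)\<close> grows by the integral of the source
  term, so it increases to a limit \<open>\<Lambda>\<close>. There are arbitrarily late long windows on which \<open>w\<close> is close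
  to its upper limit at an \<open>\<eta>\<close>-dense set of points, and others where the same holds for its lower
  limit. Slow decrease makes a value an approximate lower bound for \<open>w\<close> just before it and an
  approximate upper bound just after it. So at the end of such windows \<open>\<Phi>\<close> is at least about
  \<open>\<mu>\<close> times the upper limit, or at most about \<open>\<mu>\<close> times the lower limit, where
  \<open>\<mu> = (\<Sum>i. p\<^sub>i * \<tau>\<^sub>i)\<close>. Both limits therefore equal \<open>\<Lambda> / \<mu>\<close>.\<close>

theorem renewal_limit:
  fixes w :: "real \<Rightarrow> real" and p \<tau> :: "'i \<Rightarrow> real"
  assumes I: "finite I" and p: "\<And>i. i \<in> I \<Longrightarrow> 0 < p i" "(\<Sum>i\<in>I. p i) = 1"
    and \<tau>: "\<And>i. i \<in> I \<Longrightarrow> 0 < \<tau> i"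
    and nd: "\<not> discrete (group_closure (\<tau> ` I))"
    and pos: "\<And>t. 0 < w t" and bdd: "\<And>t. w t \<le> B"
    and slow: "\<And>x y. x \<le> y \<Longrightarrow> w y \<le> exp (a * (y - x)) * w x" and a: "0 \<le> a"
    and source: "\<And>t. (\<Sum>i\<in>I. p i * w (t - \<tau> i)) \<le> w t"
    and source_lim: "((\<lambda>t. w t - (\<Sum>i\<in>I. p i * w (t - \<tau> i))) \<longlongrightarrow> 0) at_top"
  shows "\<exists>L>0. (w \<longlongrightarrow> L) at_top"
proof -
  have abs: "\<bar>w t\<bar> \<le> B" for t using pos[of t] bdd[of t] by simp
  have int: "w integrable_on {x..y}" for x y
    using slow abs by (rule slowly_decreasing_integrable)
  have "I \<noteq> {}" using p by auto
  define K where "K = Max (\<tau> ` I)"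
  have K: "\<tau> i \<le> K" if "i \<in> I" for i using that I by (auto simp: K_def)
  have K0: "0 \<le> K" using \<open>I \<noteq> {}\<close> K \<tau> by (metis all_not_in_conv less_imp_le order_trans)
  define \<mu> where "\<mu> = (\<Sum>i\<in>I. p i * \<tau> i)"
  have \<mu>: "0 < \<mu>" unfolding \<mu>_def using I \<open>I \<noteq> {}\<close> p \<tau> by (intro sum_pos) auto
  define \<Phi> where "\<Phi> t = (\<Sum>i\<in>I. p i * integral {t - \<tau> i..t} w)" for t
  have \<Phi>_ge: "\<mu> * c \<le> \<Phi> t" if c: "\<And>x. x \<in> {t - K..t} \<Longrightarrow> c \<le> w x" for t c
  proof -
    have "p i * \<tau> i * c \<le> p i * integral {t - \<tau> i..t} w" if i: "i \<in> I" for i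
    proof -
      have "integral {t - \<tau> i..t} (\<lambda>_. c) \<le> integral {t - \<tau> i..t} w"
        by (rule integral_le) (use int K[OF i] c in auto)
      then have "\<tau> i * c \<le> integral {t - \<tau> i..t} w" using \<tau>[OF i] by simp
      then show ?thesis using p(1)[OF i] by (simp add: mult.assoc)
    qed
    then show ?thesis unfolding \<mu>_def \<Phi>_def by (simp add: sum_distrib_right sum_mono)
  qed
  have \<Phi>_le: "\<Phi> t \<le> \<mu> * c" if c: "\<And>x. x \<in> {t - K..t} \<Longrightarrow> w x \<le> c" for t c
  proof -
    have "p i * integral {t - \<tau> i..t} w \<le> p i * \<tau> i * c" if i: "i \<in> I" for i
    proof -
      have "integral {t - \<tau> i..t} w \<le> integral {t - \<tau> i..t} (\<lambda>_. c)"
        by (rule integral_le) (use int K[OF i] c in auto)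
      then have "integral {t - \<tau> i..t} w \<le> \<tau> i * c" using \<tau>[OF i] by simp
      then show ?thesis using p(1)[OF i] by (simp add: mult.assoc)
    qed
    then show ?thesis unfolding \<mu>_def \<Phi>_def by (simp add: sum_distrib_right sum_mono)
  qed
  have mono: "\<Phi> s \<le> \<Phi> t" if st: "s \<le> t" for s t
  proof -
    have shift: "((\<lambda>x. w (x - \<tau> i)) has_integral integral {s - \<tau> i..t - \<tau> i} w) {s..t}" for i
    proof -
      have "(w \<circ> (+) (- \<tau> i) has_integral integral {s - \<tau> i..t - \<tau> i} w) {s..t}"
        unfolding has_integral_shift_Icc_real using int[of "s - \<tau> i" "t - \<tau> i"]
        by (simp add: integrable_integral)
      then show ?thesis by (simp add: o_def)
    qed
    have "((\<lambda>x. \<Sum>i\<in>I. p i * w (x - \<tau> i)) has_integral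
        (\<Sum>i\<in>I. p i * integral {s - \<tau> i..t - \<tau> i} w)) {s..t}"
      by (intro has_integral_sum I has_integral_mult_right shift)
    then have le: "(\<Sum>i\<in>I. p i * integral {s - \<tau> i..t - \<tau> i} w) \<le> integral {s..t} w"
      using source by (intro has_integral_le[OF _ integrable_integral[OF int]]) auto
    have split: "integral {t - \<tau> i..t} w - integral {s - \<tau> i..s} w =
        integral {s..t} w - integral {s - \<tau> i..t - \<tau> i} w" if "i \<in> I" for i
    proof -
      have "integral {s - \<tau> i..s} w + integral {s..t} w = integral {s - \<tau> i..t} w"
        using st \<tau>[OF that] by (intro Henstock_Kurzweil_Integration.integral_combine int) auto
      moreover have "integral {s - \<tau> i..t - \<tau> i} w + integral {t - \<tau> i..t} w = integral {s - \<tau> i..t} w"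
        using st \<tau>[OF that] by (intro Henstock_Kurzweil_Integration.integral_combine int) auto
      ultimately show ?thesis by simp
    qed
    have "\<Phi> t - \<Phi> s = (\<Sum>i\<in>I. p i * (integral {s..t} w - integral {s - \<tau> i..t - \<tau> i} w))"
      unfolding \<Phi>_def using split
      by (simp add: sum_subtractf[symmetric] right_diff_distrib[symmetric])
    also have "\<dots> = integral {s..t} w - (\<Sum>i\<in>I. p i * integral {s - \<tau> i..t - \<tau> i} w)"
      using p(2) by (simp add: right_diff_distrib sum_subtractf sum_distrib_right[symmetric])
    finally show ?thesis using le by simp
  qed
  have bb: "bdd_above (range \<Phi>)"
    using \<Phi>_le[of _ B] bdd by (auto intro!: bdd_aboveI)
  define \<Lambda> where "\<Lambda> = (SUP t. \<Phi> t)"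
  have \<Phi>\<Lambda>: "\<Phi> t \<le> \<Lambda>" for t unfolding \<Lambda>_def using bb by (intro cSUP_upper) auto
  have \<Phi>_ev: "\<forall>\<^sub>F t in at_top. \<Lambda> - e < \<Phi> t" if "0 < e" for e
  proof -
    have "\<Lambda> - e < \<Lambda>" using that by simp
    then obtain t where t: "\<Lambda> - e < \<Phi> t"
      unfolding \<Lambda>_def using less_cSUP_iff[OF _ bb, of "\<Lambda> - e"] by (auto simp: \<Lambda>_def)
    show ?thesis
      unfolding eventually_at_top_linorder using t mono by (meson less_le_trans)
  qed
  have "0 < \<Phi> 0"
  proof -
    have "exp (- a * K) * w 0 \<le> w x" if x: "x \<in> {0 - K..0}" for x
    proof -
      have "w 0 \<le> exp (a * (0 - x)) * w x" using x by (intro slow) auto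
      also have "\<dots> \<le> exp (a * K) * w x"
        using mult_left_mono[of "0 - x" K a] x a pos[of x] by (intro mult_right_mono) auto
      finally show ?thesis by (simp add: exp_minus field_simps)
    qed
    then have "\<mu> * (exp (- a * K) * w 0) \<le> \<Phi> 0" by (rule \<Phi>_ge)
    moreover have "0 < \<mu> * (exp (- a * K) * w 0)" using \<mu> pos by simp
    ultimately show ?thesis by linarith
  qed
  then have \<Lambda>0: "0 < \<Lambda>" using \<Phi>\<Lambda>[of 0] by linarith
  have T: "\<tau> ` I \<subseteq> {0..}" using \<tau> by (auto intro: less_imp_le)

  obtain M f where M: "\<And>e. 0 < e \<Longrightarrow> \<forall>\<^sub>F t in at_top. w t \<le> M + e"
    and f: "filterlim f at_top sequentially"
    and fM: "\<And>\<sigma>. \<sigma> \<in> finite_sums (\<tau> ` I) \<Longrightarrow> (\<lambda>n. w (f n - \<sigma>)) \<longlonglongrightarrow> M"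
    using limsup_along_translates[of w B I p \<tau>] abs I p source_lim by blast
  have M_le: "\<mu> * exp (- a * \<eta>) * (M - \<eta>) \<le> \<Lambda>" if \<eta>: "0 < \<eta>" for \<eta>
  proof -
    obtain L where "\<forall>\<^sub>F n in sequentially. \<forall>x\<in>{f n - L - K..f n - L}.
        \<exists>y\<in>{x..x + \<eta>}. \<bar>w y - M\<bar> < \<eta>"
      by (rule near_limsup_on_long_windows[OF T nd fM \<eta> K0])
    then obtain n where n: "\<And>x. x \<in> {f n - L - K..f n - L} \<Longrightarrow> \<exists>y\<in>{x..x + \<eta>}. \<bar>w y - M\<bar> < \<eta>"
      using eventually_happens'[OF sequentially_bot] by blast
    have "exp (- a * \<eta>) * (M - \<eta>) \<le> w x" if x: "x \<in> {f n - L - K..f n - L}" for x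
    proof -
      obtain y where y: "x \<le> y" "y \<le> x + \<eta>" "\<bar>w y - M\<bar> < \<eta>" using n[OF x] by auto
      have "M - \<eta> \<le> w y" using y by linarith
      also have "\<dots> \<le> exp (a * (y - x)) * w x" using y by (intro slow)
      also have "\<dots> \<le> exp (a * \<eta>) * w x"
        using mult_left_mono[of "y - x" \<eta> a] y a pos[of x] by (intro mult_right_mono) auto
      finally show ?thesis by (simp add: exp_minus field_simps)
    qed
    then have "\<mu> * (exp (- a * \<eta>) * (M - \<eta>)) \<le> \<Phi> (f n - L)" by (rule \<Phi>_ge)
    then show ?thesis using \<Phi>\<Lambda>[of "f n - L"] by (simp add: mult.assoc)
  qed
  have "((\<lambda>\<eta>. \<mu> * exp (- a * \<eta>) * (M - \<eta>)) \<longlongrightarrow> \<mu> * exp (- a * 0) * (M - 0)) (at_right 0)"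
    by (intro tendsto_intros)
  then have "\<mu> * exp (- a * 0) * (M - 0) \<le> \<Lambda>"
    by (rule tendsto_upperbound)
      (use M_le in \<open>auto simp: eventually_at_filter intro!: always_eventually\<close>)
  then have M1: "M \<le> \<Lambda> / \<mu>" using \<mu> by (simp add: field_simps)

  \<comment> \<open>The lower limit \<open>- M'\<close> is obtained by applying the same lemma to \<open>- w\<close>.\<close>
  have "((\<lambda>t. - (w t - (\<Sum>i\<in>I. p i * w (t - \<tau> i)))) \<longlongrightarrow> - 0) at_top"
    by (intro tendsto_minus source_lim)
  then have "((\<lambda>t. - w t - (\<Sum>i\<in>I. p i * - w (t - \<tau> i))) \<longlongrightarrow> 0) at_top"
    by (simp add: sum_negf)
  moreover have "\<bar>- w t\<bar> \<le> B" for t using abs by simp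
  ultimately obtain M' f' where M': "\<And>e. 0 < e \<Longrightarrow> \<forall>\<^sub>F t in at_top. - w t \<le> M' + e"
    and f': "filterlim f' at_top sequentially"
    and fM': "\<And>\<sigma>. \<sigma> \<in> finite_sums (\<tau> ` I) \<Longrightarrow> (\<lambda>n. - w (f' n - \<sigma>)) \<longlonglongrightarrow> M'"
    using limsup_along_translates[of "\<lambda>t. - w t" B I p \<tau>] I p by blast
  have M'_le: "\<Lambda> - \<eta> \<le> \<mu> * (exp (a * \<eta>) * (- M' + \<eta>))" if \<eta>: "0 < \<eta>" for \<eta>
  proof -
    obtain L where L: "\<forall>\<^sub>F n in sequentially. \<forall>x\<in>{f' n - L - (K + \<eta>)..f' n - L}.
        \<exists>y\<in>{x..x + \<eta>}. \<bar>- w y - M'\<bar> < \<eta>"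
      by (rule near_limsup_on_long_windows[OF T nd fM' \<eta>, of "K + \<eta>"]) (use K0 \<eta> in auto)
    have "filterlim (\<lambda>n. f' n - L) at_top sequentially"
      using filterlim_tendsto_add_at_top[OF tendsto_const[of "-L"] f'] by simp
    then have "\<forall>\<^sub>F n in sequentially. \<Lambda> - \<eta> < \<Phi> (f' n - L)"
      by (rule eventually_compose_filterlim[OF \<Phi>_ev[OF \<eta>]])
    from eventually_happens'[OF sequentially_bot eventually_conj[OF L this]]
    obtain n where n: "\<And>x. x \<in> {f' n - L - (K + \<eta>)..f' n - L} \<Longrightarrow> \<exists>y\<in>{x..x + \<eta>}. \<bar>- w y - M'\<bar> < \<eta>"
      and \<Phi>n: "\<Lambda> - \<eta> < \<Phi> (f' n - L)" by blast
    have "w x \<le> exp (a * \<eta>) * (- M' + \<eta>)" if x: "x \<in> {f' n - L - K..f' n - L}" for x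
    proof -
      have "x - \<eta> \<in> {f' n - L - (K + \<eta>)..f' n - L}" using x \<eta> by auto
      then obtain y where y: "x - \<eta> \<le> y" "y \<le> x" "\<bar>- w y - M'\<bar> < \<eta>" using n by fastforce
      have "w x \<le> exp (a * (x - y)) * w y" using y by (intro slow)
      also have "\<dots> \<le> exp (a * \<eta>) * w y"
        using mult_left_mono[of "x - y" \<eta> a] y a pos[of y] by (intro mult_right_mono) auto
      also have "\<dots> \<le> exp (a * \<eta>) * (- M' + \<eta>)" using y by (intro mult_left_mono) auto
      finally show ?thesis .
    qed
    then have "\<Phi> (f' n - L) \<le> \<mu> * (exp (a * \<eta>) * (- M' + \<eta>))" by (rule \<Phi>_le)
    then show ?thesis using \<Phi>n by simp
  qed
  have "((\<lambda>\<eta>. \<mu> * (exp (a * \<eta>) * (- M' + \<eta>)) - (\<Lambda> - \<eta>)) \<longlongrightarrow>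
      \<mu> * (exp (a * 0) * (- M' + 0)) - (\<Lambda> - 0)) (at_right 0)"
    by (intro tendsto_intros)
  then have "0 \<le> \<mu> * (exp (a * 0) * (- M' + 0)) - (\<Lambda> - 0)"
    by (rule tendsto_lowerbound)
      (use M'_le in \<open>auto simp: eventually_at_filter intro!: always_eventually\<close>)
  then have M2: "\<Lambda> / \<mu> \<le> - M'" using \<mu> by (simp add: field_simps)

  have "(w \<longlongrightarrow> \<Lambda> / \<mu>) at_top"
  proof (rule tendstoI)
    fix e :: real assume e: "0 < e"
    then have "0 < e / 2" by simp
    from M[OF this] M'[OF this] show "\<forall>\<^sub>F t in at_top. dist (w t) (\<Lambda> / \<mu>) < e"
      by eventually_elim (use M1 M2 e in \<open>auto simp: dist_real_def abs_if\<close>)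
  qed
  then show ?thesis using \<Lambda>0 \<mu> by (intro exI[of _ "\<Lambda> / \<mu>"]) auto
qed

section \<open>Lebesgue measure under similarities\<close>

lemma emeasure_lebesgue_ball_scale:
  fixes a b :: "'a::euclidean_space"
  assumes "0 \<le> c" "0 \<le> \<rho>"
  shows "emeasure lebesgue (ball a (c * \<rho>)) = ennreal (c ^ DIM('a)) * emeasure lebesgue (ball b \<rho>)"
proof -
  have "emeasure lebesgue (ball a (c * \<rho>)) = ennreal (unit_ball_vol (real DIM('a)) * (c * \<rho>) ^ DIM('a))"
    using assms emeasure_ball[of "c * \<rho>" a] by simp
  also have "\<dots> = ennreal (c ^ DIM('a)) * ennreal (unit_ball_vol (real DIM('a)) * \<rho> ^ DIM('a))"
    using assms by (simp add: ennreal_mult[symmetric] power_mult_distrib algebra_simps)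
  also have "\<dots> = ennreal (c ^ DIM('a)) * emeasure lebesgue (ball b \<rho>)"
    using assms emeasure_ball[of \<rho> b] by simp
  finally show ?thesis .
qed

lemma lipschitz_image_measurable:
  fixes f :: "'a::euclidean_space \<Rightarrow> 'a"
  assumes A: "A \<in> sets lebesgue" and r: "0 \<le> r"
    and lip: "\<And>x y. x \<in> A \<Longrightarrow> y \<in> A \<Longrightarrow> dist (f x) (f y) \<le> r * dist x y"
  shows "f ` A \<in> sets lebesgue"
proof (rule sets_lebesgue_continuous_image[OF A _ _ order_refl])
  show "continuous_on A f"
    by (rule lipschitz_on_continuous_on[of r]) (use r lip in \<open>auto intro!: lipschitz_onI\<close>)
  fix T assume T: "negligible T" "T \<subseteq> A"
  show "negligible (f ` T)"
  proof (rule negligible_locally_Lipschitz_image)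
    fix x assume "x \<in> T"
    then show "\<exists>V B. open V \<and> x \<in> V \<and> (\<forall>y\<in>T \<inter> V. norm (f y - f x) \<le> B * norm (y - x))"
      using T lip by (intro exI[of _ UNIV] exI[of _ r]) (auto simp: dist_norm)
  qed (use T in auto)
qed

text \<open>By Vitali's theorem, almost all of \<open>A\<close> is covered by disjoint balls centred in \<open>A\<close> of total
  measure hardly larger than that of \<open>A\<close>; the map sends each ball into a ball whose radius
  is at most \<open>r\<close> times as large.\<close>

lemma emeasure_lipschitz_image_le:
  fixes f :: "'a::euclidean_space \<Rightarrow> 'a"
  assumes A: "A \<in> sets lebesgue" and r: "0 < r"
    and lip: "\<And>x y. x \<in> A \<Longrightarrow> y \<in> A \<Longrightarrow> dist (f x) (f y) \<le> r * dist x y"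
  shows "emeasure lebesgue (f ` A) \<le> ennreal (r ^ DIM('a)) * emeasure lebesgue A"
proof -
  define c where "c = ennreal (r ^ DIM('a))"
  have le: "emeasure lebesgue (f ` A) \<le> c * (emeasure lebesgue A + ennreal e)" if e: "0 < e" for e
  proof -
    obtain T where T: "open T" "A \<subseteq> T" "T - A \<in> lmeasurable" "emeasure lebesgue (T - A) < ennreal e"
      using sets_lebesgue_outer_open[OF A e] .
    define K where "K = {(x, \<rho>). x \<in> A \<and> 0 < \<rho> \<and> ball x \<rho> \<subseteq> T}"
    have "\<exists>i. i \<in> K \<and> x \<in> ball (fst i) (snd i) \<and> snd i < d" if x: "x \<in> A" and d: "0 < d" for x d
    proof -
      obtain \<rho> where \<rho>: "0 < \<rho>" "ball x \<rho> \<subseteq> T"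
        using T(1,2) x unfolding open_contains_ball by blast
      then show ?thesis
        using x d by (intro exI[of _ "(x, min \<rho> (d / 2))"]) (auto simp: K_def)
    qed
    then obtain C where C: "countable C" "C \<subseteq> K"
      "pairwise (\<lambda>i j. disjnt (ball (fst i) (snd i)) (ball (fst j) (snd j))) C"
      "negligible (A - (\<Union>i\<in>C. ball (fst i) (snd i)))"
      by (rule Vitali_covering_theorem_balls)
    \<comment> \<open>The countable family \<open>C\<close>, enumerated by the natural numbers and padded with balls of radius
      zero, which are empty.\<close>
    define J where "J = to_nat_on C ` C"
    define x where "x n = fst (from_nat_into C n)" for n
    define \<rho> where "\<rho> n = (if n \<in> J then snd (from_nat_into C n) else 0)" for n
    have inC: "from_nat_into C n \<in> C" if "n \<in> J" for n
      using that C(1) by (auto simp: J_def)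
    have Un: "(\<Union>i\<in>C. ball (fst i) (snd i)) = (\<Union>n. ball (x n) (\<rho> n))"
    proof (intro equalityI subsetI)
      fix y assume "y \<in> (\<Union>i\<in>C. ball (fst i) (snd i))"
      then obtain i where "i \<in> C" "y \<in> ball (fst i) (snd i)" by blast
      then have "y \<in> ball (x (to_nat_on C i)) (\<rho> (to_nat_on C i))"
        using C(1) by (simp add: x_def \<rho>_def J_def)
      then show "y \<in> (\<Union>n. ball (x n) (\<rho> n))" by blast
    next
      fix y assume "y \<in> (\<Union>n. ball (x n) (\<rho> n))"
      then obtain n where n: "y \<in> ball (x n) (\<rho> n)" by blast
      then have "n \<in> J" by (auto simp: \<rho>_def split: if_splits)
      then show "y \<in> (\<Union>i\<in>C. ball (fst i) (snd i))"
        using n inC by (auto simp: x_def \<rho>_def intro!: bexI[of _ "from_nat_into C n"])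
    qed
    have ball: "\<rho> n = 0 \<or> x n \<in> A \<and> 0 < \<rho> n \<and> ball (x n) (\<rho> n) \<subseteq> T" for n
      using inC[of n] C(2) by (cases "from_nat_into C n") (auto simp: K_def x_def \<rho>_def)
    then have \<rho>0: "0 \<le> \<rho> n" for n by (metis less_imp_le order_refl)
    have disj: "disjoint_family (\<lambda>n. ball (x n) (\<rho> n))"
      unfolding disjoint_family_on_def
    proof (intro ballI impI)
      fix m n :: nat assume mn: "m \<noteq> n"
      show "ball (x m) (\<rho> m) \<inter> ball (x n) (\<rho> n) = {}"
      proof (cases "m \<in> J \<and> n \<in> J")
        case True
        then have "from_nat_into C m \<noteq> from_nat_into C n"
          using mn C(1) by (auto simp: J_def)
        then show ?thesis
          using C(3) inC True by (auto simp: pairwise_def disjnt_def x_def \<rho>_def)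
      qed (auto simp: \<rho>_def)
    qed
    have "(\<Sum>n. emeasure lebesgue (ball (x n) (\<rho> n))) = emeasure lebesgue (\<Union>n. ball (x n) (\<rho> n))"
      using disj by (intro suminf_emeasure) auto
    also have "\<dots> \<le> emeasure lebesgue (A \<union> (T - A))"
    proof (rule emeasure_mono)
      show "(\<Union>n. ball (x n) (\<rho> n)) \<subseteq> A \<union> (T - A)"
      proof
        fix y assume "y \<in> (\<Union>n. ball (x n) (\<rho> n))"
        then obtain n where n: "y \<in> ball (x n) (\<rho> n)" by blast
        then have "\<rho> n \<noteq> 0" by auto
        then show "y \<in> A \<union> (T - A)" using n ball[of n] by auto
      qed
    qed (use A T in auto)
    also have "\<dots> \<le> emeasure lebesgue A + emeasure lebesgue (T - A)"
      using A T by (intro emeasure_subadditive) auto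
    also have "\<dots> \<le> emeasure lebesgue A + ennreal e"
      using T by (intro add_left_mono) auto
    finally have sum: "(\<Sum>n. emeasure lebesgue (ball (x n) (\<rho> n))) \<le> emeasure lebesgue A + ennreal e" .

    define Z where "Z = f ` (A - (\<Union>n. ball (x n) (\<rho> n)))"
    have negZ: "negligible Z"
      unfolding Z_def
    proof (rule negligible_locally_Lipschitz_image)
      show "negligible (A - (\<Union>n. ball (x n) (\<rho> n)))" using C(4) Un by simp
      fix y assume "y \<in> A - (\<Union>n. ball (x n) (\<rho> n))"
      then show "\<exists>V B. open V \<and> y \<in> V \<and>
          (\<forall>z\<in>(A - (\<Union>n. ball (x n) (\<rho> n))) \<inter> V. norm (f z - f y) \<le> B * norm (z - y))"
        using lip by (intro exI[of _ UNIV] exI[of _ r]) (auto simp: dist_norm)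
    qed auto
    define R where "R n = ball (f (x n)) (r * \<rho> n)" for n
    have R: "emeasure lebesgue (R n) = c * emeasure lebesgue (ball (x n) (\<rho> n))" for n
      unfolding R_def c_def using r \<rho>0 by (intro emeasure_lebesgue_ball_scale) auto
    have "f ` A \<subseteq> Z \<union> (\<Union>n. R n)"
    proof
      fix z assume "z \<in> f ` A"
      then obtain y where y: "y \<in> A" "z = f y" by blast
      show "z \<in> Z \<union> (\<Union>n. R n)"
      proof (cases "y \<in> (\<Union>n. ball (x n) (\<rho> n))")
        case True
        then obtain n where n: "y \<in> ball (x n) (\<rho> n)" by blast
        then have "\<rho> n \<noteq> 0" by auto
        then have "x n \<in> A" using ball[of n] by auto
        then have "dist (f (x n)) (f y) \<le> r * dist (x n) y" using lip y by auto
        moreover have "r * dist (x n) y < r * \<rho> n" using n r by simp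
        ultimately have "z \<in> R n" using y by (simp add: R_def)
        then show ?thesis by blast
      qed (use y in \<open>auto simp: Z_def\<close>)
    qed
    moreover have RM: "R n \<in> sets lebesgue" for n by (auto simp: R_def)
    moreover have ZM: "Z \<in> sets lebesgue" using negZ by (rule negligible_imp_sets)
    ultimately have "emeasure lebesgue (f ` A) \<le> emeasure lebesgue (Z \<union> (\<Union>n. R n))"
      by (intro emeasure_mono) auto
    also have "\<dots> \<le> emeasure lebesgue Z + emeasure lebesgue (\<Union>n. R n)"
      using ZM RM by (intro emeasure_subadditive) auto
    also have "\<dots> \<le> 0 + (\<Sum>n. emeasure lebesgue (R n))"
      using negZ ZM RM
      by (intro add_mono emeasure_subadditive_countably) (auto simp: negligible_iff_emeasure0)
    also have "\<dots> = c * (\<Sum>n. emeasure lebesgue (ball (x n) (\<rho> n)))"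
      unfolding R by simp
    also have "\<dots> \<le> c * (emeasure lebesgue A + ennreal e)"
      using sum by (intro mult_left_mono) auto
    finally show ?thesis .
  qed
  have "((\<lambda>e. c * (emeasure lebesgue A + ennreal e)) \<longlongrightarrow> c * (emeasure lebesgue A + ennreal 0)) (at_right 0)"
    by (intro tendsto_intros ennreal_tendsto_cmult) (auto simp: c_def)
  then have "emeasure lebesgue (f ` A) \<le> c * (emeasure lebesgue A + ennreal 0)"
    by (rule tendsto_lowerbound) (use le in \<open>auto simp: eventually_at_filter intro!: always_eventually\<close>)
  then show ?thesis by (simp add: c_def)
qed

text \<open>The Lipschitz estimate applied to the map and to its inverse.\<close>

lemma measure_similarity_image:
  fixes f :: "'a::euclidean_space \<Rightarrow> 'a"
  assumes A: "A \<in> sets lebesgue" and r: "0 < r"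
    and sim: "\<And>x y. dist (f x) (f y) = r * dist x y"
  shows "f ` A \<in> sets lebesgue" and "measure lebesgue (f ` A) = r ^ DIM('a) * measure lebesgue A"
proof -
  show fA: "f ` A \<in> sets lebesgue"
    by (rule lipschitz_image_measurable[OF A, of r]) (use r sim in auto)
  have inj: "inj f" using sim r by (auto intro!: injI) (metis dist_eq_0_iff mult_eq_0_iff less_irrefl)
  have "emeasure lebesgue (inv f ` f ` A) \<le> ennreal ((1 / r) ^ DIM('a)) * emeasure lebesgue (f ` A)"
    by (rule emeasure_lipschitz_image_le[OF fA]) (use r sim inj in auto)
  then have "ennreal (r ^ DIM('a)) * emeasure lebesgue A \<le>
      ennreal (r ^ DIM('a)) * (ennreal ((1 / r) ^ DIM('a)) * emeasure lebesgue (f ` A))"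
    using inj by (intro mult_left_mono) (auto simp: image_image)
  also have "\<dots> = emeasure lebesgue (f ` A)"
    using r by (simp add: mult.assoc[symmetric] ennreal_mult[symmetric] power_mult_distrib[symmetric])
  finally have "emeasure lebesgue (f ` A) = ennreal (r ^ DIM('a)) * emeasure lebesgue A"
    using emeasure_lipschitz_image_le[OF A, of r f] r sim by (intro antisym) auto
  then show "measure lebesgue (f ` A) = r ^ DIM('a) * measure lebesgue A"
    using r by (simp add: measure_def enn2real_mult)
qed

lemma similarity_surj:
  fixes f :: "'a::euclidean_space \<Rightarrow> 'a"
  assumes r: "0 < r" and sim: "\<And>x y. dist (f x) (f y) = r * dist x y"
  shows "surj f"
proof -
  define g where "g x = f x - f 0" for x
  have "linear g"
    by (rule scaling_linear[of _ r]) (use sim in \<open>auto simp: g_def dist_norm\<close>)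
  moreover have "inj g"
    using sim r by (intro injI) (metis add_right_cancel diff_add_cancel dist_eq_0_iff g_def less_irrefl mult_eq_0_iff)
  ultimately have "surj g" by (rule linear_inj_imp_surj)
  show ?thesis
    unfolding surj_def
  proof
    fix y
    from \<open>surj g\<close> obtain x where "g x = y - f 0" by (metis surjD)
    then show "\<exists>x. y = f x" by (intro exI[of _ x]) (simp add: g_def)
  qed
qed

section \<open>Parallel sets\<close>

lemma infdist_similarity_image:
  fixes f :: "'a::euclidean_space \<Rightarrow> 'a"
  assumes A: "closed A" and r: "0 < r"
    and sim: "\<And>x y. dist (f x) (f y) = r * dist x y"
  shows "infdist (f x) (f ` A) = r * infdist x A"
proof (cases "A = {}")
  case False
  show ?thesis
  proof (rule antisym)
    obtain a where a: "a \<in> A" "infdist x A = dist x a"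
      using infdist_attains_inf[OF A False] by metis
    have "infdist (f x) (f ` A) \<le> dist (f x) (f a)" using a by (intro infdist_le) auto
    then show "infdist (f x) (f ` A) \<le> r * infdist x A" using a sim by simp
  next
    have "r * infdist x A \<le> dist (f x) b" if b: "b \<in> f ` A" for b
      using b sim r infdist_le[of _ A x] by auto
    then show "r * infdist x A \<le> infdist (f x) (f ` A)"
      using False by (simp add: infdist_notempty cINF_greatest)
  qed
qed (simp add: infdist_def)

lemma parallel_set_similarity_image:
  fixes f :: "'a::euclidean_space \<Rightarrow> 'a"
  assumes A: "closed A" and r: "0 < r"
    and sim: "\<And>x y. dist (f x) (f y) = r * dist x y"
  shows "parallel_set (f ` A) \<epsilon> = f ` parallel_set A (\<epsilon> / r)"
proof (intro equalityI subsetI)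
  fix y assume "y \<in> parallel_set (f ` A) \<epsilon>"
  moreover obtain x where "y = f x" using similarity_surj[OF r sim] by (metis surjD)
  ultimately show "y \<in> f ` parallel_set A (\<epsilon> / r)"
    using infdist_similarity_image[OF A r sim] r by (auto simp: parallel_set_def field_simps)
next
  fix y assume "y \<in> f ` parallel_set A (\<epsilon> / r)"
  then show "y \<in> parallel_set (f ` A) \<epsilon>"
    using infdist_similarity_image[OF A r sim] r by (auto simp: parallel_set_def field_simps)
qed

lemma parallel_set_mono: "\<delta> \<le> \<epsilon> \<Longrightarrow> parallel_set A \<delta> \<subseteq> parallel_set A \<epsilon>"
  by (auto simp: parallel_set_def)

lemma subset_parallel_set: "0 \<le> \<epsilon> \<Longrightarrow> A \<subseteq> parallel_set A \<epsilon>"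
  by (auto simp: parallel_set_def)

lemma compact_parallel_set:
  fixes A :: "'a::euclidean_space set"
  assumes "compact A" "A \<noteq> {}"
  shows "compact (parallel_set A \<epsilon>)"
proof -
  have "closed (parallel_set A \<epsilon>)"
    unfolding parallel_set_def by (intro closed_Collect_le continuous_intros)
  moreover have "bounded (parallel_set A \<epsilon>)"
  proof -
    obtain B where B: "\<And>x. x \<in> A \<Longrightarrow> norm x \<le> B"
      using compact_imp_bounded[OF assms(1)] by (auto simp: bounded_iff)
    have "norm x \<le> \<epsilon> + B" if x: "x \<in> parallel_set A \<epsilon>" for x
    proof -
      obtain a where a: "a \<in> A" "infdist x A = dist x a"
        using infdist_attains_inf[OF compact_imp_closed[OF assms(1)] assms(2)] by metis
      then have "dist x a \<le> \<epsilon>" using x by (simp add: parallel_set_def)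
      moreover have "norm x \<le> dist x a + norm a"
        by (metis add.commute dist_norm norm_triangle_sub)
      ultimately show ?thesis using B[OF a(1)] by linarith
    qed
    then show ?thesis by (auto simp: bounded_iff)
  qed
  ultimately show ?thesis by (simp add: compact_eq_bounded_closed)
qed

lemma parallel_set_lmeasurable:
  fixes A :: "'a::euclidean_space set"
  assumes "compact A" "A \<noteq> {}"
  shows "parallel_set A \<epsilon> \<in> lmeasurable"
  using compact_parallel_set[OF assms] by (rule lmeasurable_compact)

text \<open>The function \<open>u \<epsilon> = \<epsilon> powr (s - d) * \<lambda> (A\<^sub>\<epsilon>)\<close> satisfies the renewal inequality
  \<open>u \<epsilon> \<le> (\<Sum>i. \<rho>\<^sub>i powr s * u (\<epsilon> / \<rho>\<^sub>i))\<close>, whose weights sum to at most one. A scale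
  \<open>\<epsilon> < 1\<close> is thus reduced to scales that are larger by at least a fixed factor but still at most \<open>1 / m\<close>,
  where \<open>m\<close> is the smallest ratio, and a bound for \<open>u\<close> on \<open>{1..1 / m}\<close> propagates to all smaller
  scales.\<close>

lemma parallel_volume_upper_bound:
  fixes T :: "'i \<Rightarrow> 'a::euclidean_space \<Rightarrow> 'a" and \<rho> :: "'i \<Rightarrow> real"
  assumes I: "finite I"
    and \<rho>: "\<And>i. i \<in> I \<Longrightarrow> 0 < \<rho> i" "\<And>i. i \<in> I \<Longrightarrow> \<rho> i < 1"
    and sim: "\<And>i x y. i \<in> I \<Longrightarrow> dist (T i x) (T i y) = \<rho> i * dist x y"
    and A: "compact A" "A \<noteq> {}" and cover: "A \<subseteq> (\<Union>i\<in>I. T i ` A)"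
    and s: "(\<Sum>i\<in>I. \<rho> i powr s) \<le> 1"
  obtains C where "0 \<le> C"
    "\<And>\<epsilon>. 0 < \<epsilon> \<Longrightarrow> \<epsilon> \<le> 1 \<Longrightarrow>
      measure lebesgue (parallel_set A \<epsilon>) \<le> C * \<epsilon> powr (real DIM('a) - s)"
proof -
  define d where "d = real DIM('a)"
  define V where "V \<epsilon> = measure lebesgue (parallel_set A \<epsilon>)" for \<epsilon>
  define u where "u \<epsilon> = \<epsilon> powr (s - d) * V \<epsilon>" for \<epsilon>
  note meas = parallel_set_lmeasurable[OF A]
  have V_mono: "V \<delta> \<le> V \<epsilon>" if "\<delta> \<le> \<epsilon>" for \<delta> \<epsilon>
    unfolding V_def using that meas by (intro measure_mono_fmeasurable parallel_set_mono) (auto dest: fmeasurableD)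
  have V0: "0 \<le> V \<epsilon>" for \<epsilon> by (simp add: V_def)
  have neI: "I \<noteq> {}" using A(2) cover by auto
  have V_le: "V \<epsilon> \<le> (\<Sum>i\<in>I. \<rho> i ^ DIM('a) * V (\<epsilon> / \<rho> i))" for \<epsilon>
  proof -
    have M: "T i ` parallel_set A (\<epsilon> / \<rho> i) \<in> sets lebesgue"
      "measure lebesgue (T i ` parallel_set A (\<epsilon> / \<rho> i)) = \<rho> i ^ DIM('a) * V (\<epsilon> / \<rho> i)"
      if "i \<in> I" for i
      unfolding V_def using that \<rho> sim meas
      by (intro measure_similarity_image; blast dest: fmeasurableD)+
    have sub: "parallel_set A \<epsilon> \<subseteq> (\<Union>i\<in>I. T i ` parallel_set A (\<epsilon> / \<rho> i))"
    proof
      fix z assume z: "z \<in> parallel_set A \<epsilon>"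
      obtain a where a: "a \<in> A" "infdist z A = dist z a"
        using infdist_attains_inf[OF compact_imp_closed[OF A(1)] A(2)] by metis
      then obtain i where i: "i \<in> I" "a \<in> T i ` A" using cover by blast
      have "infdist z (T i ` A) \<le> dist z a" using i by (intro infdist_le)
      then have "z \<in> parallel_set (T i ` A) \<epsilon>" using a z by (simp add: parallel_set_def)
      then show "z \<in> (\<Union>i\<in>I. T i ` parallel_set A (\<epsilon> / \<rho> i))"
        using parallel_set_similarity_image[OF compact_imp_closed[OF A(1)] \<rho>(1)[OF i(1)] sim[OF i(1)]] i
        by auto
    qed
    have "T i ` parallel_set A (\<epsilon> / \<rho> i) \<in> lmeasurable" if i: "i \<in> I" for i
    proof (rule lmeasurable_compact)
      have "parallel_set (T i ` A) \<epsilon> = T i ` parallel_set A (\<epsilon> / \<rho> i)"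
        using parallel_set_similarity_image[OF compact_imp_closed[OF A(1)] \<rho>(1)[OF i] sim[OF i]] .
      moreover have "continuous_on A (T i)"
        by (rule lipschitz_on_continuous_on[of "\<rho> i"])
          (use \<rho>(1)[OF i] sim[OF i] in \<open>auto intro!: lipschitz_onI\<close>)
      then have "compact (T i ` A)" using A by (intro compact_continuous_image)
      then have "compact (parallel_set (T i ` A) \<epsilon>)"
        using A by (intro compact_parallel_set) auto
      ultimately show "compact (T i ` parallel_set A (\<epsilon> / \<rho> i))" by simp
    qed
    then have "V \<epsilon> \<le> measure lebesgue (\<Union>i\<in>I. T i ` parallel_set A (\<epsilon> / \<rho> i))"
      unfolding V_def using sub I meas
      by (intro measure_mono_fmeasurable) (auto dest: fmeasurableD intro!: fmeasurable.finite_UN)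
    also have "\<dots> \<le> (\<Sum>i\<in>I. measure lebesgue (T i ` parallel_set A (\<epsilon> / \<rho> i)))"
      using I M by (intro measure_UNION_le)
    also have "\<dots> = (\<Sum>i\<in>I. \<rho> i ^ DIM('a) * V (\<epsilon> / \<rho> i))" using M by simp
    finally show ?thesis .
  qed
  have u_le: "u \<epsilon> \<le> (\<Sum>i\<in>I. \<rho> i powr s * u (\<epsilon> / \<rho> i))" if \<epsilon>: "0 < \<epsilon>" for \<epsilon>
  proof -
    have "u \<epsilon> \<le> \<epsilon> powr (s - d) * (\<Sum>i\<in>I. \<rho> i ^ DIM('a) * V (\<epsilon> / \<rho> i))"
      unfolding u_def using V_le by (intro mult_left_mono) auto
    also have "\<dots> = (\<Sum>i\<in>I. \<rho> i powr s * u (\<epsilon> / \<rho> i))"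
      unfolding sum_distrib_left
    proof (rule sum.cong)
      fix i assume i: "i \<in> I"
      have "\<rho> i powr s * (\<epsilon> / \<rho> i) powr (s - d) = \<epsilon> powr (s - d) * \<rho> i powr d"
        using \<epsilon> \<rho>(1)[OF i] by (simp add: powr_divide powr_diff field_simps)
      also have "\<rho> i powr d = \<rho> i ^ DIM('a)"
        using \<rho>(1)[OF i] by (simp add: d_def powr_realpow)
      finally show "\<epsilon> powr (s - d) * (\<rho> i ^ DIM('a) * V (\<epsilon> / \<rho> i)) = \<rho> i powr s * u (\<epsilon> / \<rho> i)"
        by (simp add: u_def mult.assoc[symmetric])
    qed simp
    finally show ?thesis .
  qed
  define q where "q = Max (\<rho> ` I)"
  define m where "m = Min (\<rho> ` I)"
  have "q \<in> \<rho> ` I" "m \<in> \<rho> ` I" using I neI by (auto simp: q_def m_def)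
  then have q: "0 < q" "q < 1" and m: "0 < m" using \<rho> by auto
  have \<rho>q: "\<rho> i \<le> q" "m \<le> \<rho> i" if "i \<in> I" for i using that I by (auto simp: q_def m_def)
  define C where "C = (1 / m) powr \<bar>s - d\<bar> * V (1 / m)"
  have C0: "0 \<le> C" using V0 by (simp add: C_def)
  have base: "u \<epsilon> \<le> C" if \<epsilon>: "1 \<le> \<epsilon>" "\<epsilon> \<le> 1 / m" for \<epsilon>
  proof -
    have "\<epsilon> powr (s - d) \<le> \<epsilon> powr \<bar>s - d\<bar>" using \<epsilon> by (intro powr_mono) auto
    also have "\<dots> \<le> (1 / m) powr \<bar>s - d\<bar>" using \<epsilon> by (intro powr_mono2) auto
    finally show ?thesis unfolding u_def C_def using V_mono[OF \<epsilon>(2)] V0 by (intro mult_mono) auto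
  qed
  have all: "u \<epsilon> \<le> C" if "q ^ n \<le> \<epsilon>" "\<epsilon> \<le> 1 / m" for n \<epsilon>
    using that
  proof (induction n arbitrary: \<epsilon>)
    case 0
    then show ?case using base by simp
  next
    case (Suc n)
    show ?case
    proof (cases "1 \<le> \<epsilon>")
      case False
      have \<epsilon>: "0 < \<epsilon>" using Suc.prems(1) q by (meson less_le_trans zero_less_power)
      have "u (\<epsilon> / \<rho> i) \<le> C" if i: "i \<in> I" for i
      proof (rule Suc.IH)
        have "q ^ n * \<rho> i \<le> q ^ n * q" using \<rho>q[OF i] q by (intro mult_left_mono) auto
        then show "q ^ n \<le> \<epsilon> / \<rho> i" using Suc.prems(1) \<rho>(1)[OF i] by (simp add: field_simps)
        show "\<epsilon> / \<rho> i \<le> 1 / m" using False \<epsilon> m \<rho>q[OF i] by (intro frac_le) auto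
      qed
      then have "(\<Sum>i\<in>I. \<rho> i powr s * u (\<epsilon> / \<rho> i)) \<le> (\<Sum>i\<in>I. \<rho> i powr s * C)"
        by (intro sum_mono mult_left_mono) auto
      also have "\<dots> \<le> 1 * C"
        unfolding sum_distrib_right[symmetric] using s C0 by (intro mult_right_mono)
      finally show ?thesis using u_le[OF \<epsilon>] by simp
    qed (use base Suc.prems in auto)
  qed
  have "V \<epsilon> \<le> C * \<epsilon> powr (d - s)" if \<epsilon>: "0 < \<epsilon>" "\<epsilon> \<le> 1" for \<epsilon>
  proof -
    obtain n where "q ^ n < \<epsilon>" using real_arch_pow_inv[OF \<epsilon>(1) q(2)] by blast
    moreover have "1 \<le> 1 / m" using m \<rho>q \<rho>(2) neI by (auto simp: field_simps) (meson less_imp_le order_trans)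
    ultimately have "u \<epsilon> \<le> C" using \<epsilon> by (intro all[of n]) auto
    then have "\<epsilon> powr (d - s) * u \<epsilon> \<le> \<epsilon> powr (d - s) * C" by (intro mult_left_mono) auto
    moreover have "\<epsilon> powr (d - s) * u \<epsilon> = V \<epsilon>"
      using \<epsilon> by (simp add: u_def mult.assoc[symmetric] powr_add[symmetric])
    ultimately show ?thesis by (simp add: mult.commute)
  qed
  with C0 that show ?thesis by (simp add: V_def d_def)
qed

section \<open>Geometry of compatible tilings\<close>

text \<open>A segment from \<open>x\<close> to a point of \<open>A\<close> outside \<open>W\<close> meets \<open>frontier W\<close>, hence \<open>B\<close>, no later than
  that point.\<close>

lemma infdist_eq_of_frontier_subset:
  fixes A B W :: "'a::euclidean_space set"
  assumes A: "closed A" and B: "B \<subseteq> A" "B \<noteq> {}"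
    and W: "frontier W \<subseteq> B" "A \<inter> W \<subseteq> B" and x: "x \<in> W"
  shows "infdist x A = infdist x B"
proof (rule antisym)
  show "infdist x A \<le> infdist x B" using B by (intro infdist_mono)
  obtain a where a: "a \<in> A" "infdist x A = dist x a"
    using infdist_attains_inf[OF A] B by (metis subset_empty)
  show "infdist x B \<le> infdist x A"
  proof (cases "a \<in> W")
    case True
    then show ?thesis using a W by (metis Int_iff infdist_le subsetD)
  next
    case False
    then have "closed_segment x a \<inter> frontier W \<noteq> {}"
      using x by (intro connected_Int_frontier) auto
    then obtain b where b: "b \<in> closed_segment x a" "b \<in> B" using W by blast
    then have "infdist x B \<le> dist x b" by (intro infdist_le)
    also have "\<dots> \<le> dist x a" using b(1) by (metis dist_commute dist_in_closed_segment)
    finally show ?thesis using a by simp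
  qed
qed

lemma measure_Un_disjoint_lmeasurable:
  assumes "A \<in> lmeasurable" "B \<in> lmeasurable" "A \<inter> B = {}"
  shows "measure lebesgue (A \<union> B) = measure lebesgue A + measure lebesgue B"
  using assms
  by (intro measure_Union) (auto dest: fmeasurableD fmeasurableD2 simp del: emeasure_completion)

text \<open>Otherwise the supremum of \<open>h\<close> would be positive and bounded by \<open>q\<close> times itself.\<close>

lemma descent_bound:
  fixes h :: "'a \<Rightarrow> real"
  assumes q: "0 \<le> q" "q < 1" and g: "0 \<le> g" and C: "\<And>x. x \<in> X \<Longrightarrow> h x \<le> C"
    and step: "\<And>x. x \<in> X \<Longrightarrow> h x \<le> g \<or> (\<exists>y\<in>X. h x \<le> q * h y)"
    and x: "x \<in> X"
  shows "h x \<le> g"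
proof (rule ccontr)
  define s where "s = (SUP x\<in>X. h x)"
  have up: "h y \<le> s" if "y \<in> X" for y
    unfolding s_def using that C by (intro cSUP_upper) (auto intro!: bdd_aboveI)
  assume "\<not> h x \<le> g"
  then have "g < s" using up[OF x] by simp
  have "s \<le> max g (q * s)"
    unfolding s_def
  proof (rule cSUP_least)
    fix y assume "y \<in> X"
    have "h y \<le> max g (q * s)"
    proof (cases "h y \<le> g")
      case False
      then obtain z where z: "z \<in> X" "h y \<le> q * h z" using step[OF \<open>y \<in> X\<close>] by blast
      moreover have "q * h z \<le> q * s" using up[OF z(1)] q by (intro mult_left_mono)
      ultimately show ?thesis by simp
    qed simp
    then show "h y \<le> max g (q * (SUP x\<in>X. h x))" by (simp add: s_def)
  qed (use x in auto)
  moreover have "q * s < s" using \<open>g < s\<close> g q by simp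
  ultimately show False using \<open>g < s\<close> by simp
qed

locale compatible_ifs =
  fixes N :: nat and S :: "nat \<Rightarrow> 'a::euclidean_space \<Rightarrow> 'a" and r :: "nat \<Rightarrow> real"
    and F U :: "'a set"
  assumes ifs: "similarity_ifs N S r" and self_similar: "self_similar_set N S F"
    and strong: "strong_feasible_open_set N S F U" and frontier_U: "frontier U \<subseteq> F"
begin

lemma N_ge_2: "2 \<le> N" using ifs by (simp add: similarity_ifs_def)

lemma ratio:
  assumes "i \<in> {1..N}" shows "0 < r i" "r i < 1" "dist (S i x) (S i y) = r i * dist x y"
  using ifs assms by (auto simp: similarity_ifs_def)

lemma compact_F: "compact F" and F_nonempty: "F \<noteq> {}" and closed_F: "closed F"
  using self_similar by (auto simp: self_similar_set_def compact_imp_closed)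

lemma F_eq: "F = (\<Union>i\<in>{1..N}. S i ` F)"
  using self_similar by (simp add: self_similar_set_def hutchinson_def)

lemma S_F_subset: "i \<in> {1..N} \<Longrightarrow> S i ` F \<subseteq> F"
  using F_eq by blast

lemma open_U: "open U" and bounded_U: "bounded U" and U_nonempty: "U \<noteq> {}"
  and U_F: "U \<inter> F \<noteq> {}"
  using strong by (auto simp: strong_feasible_open_set_def feasible_open_set_def)

lemma S_U_subset: "i \<in> {1..N} \<Longrightarrow> S i ` U \<subseteq> U"
  and S_U_disjoint: "i \<in> {1..N} \<Longrightarrow> j \<in> {1..N} \<Longrightarrow> i \<noteq> j \<Longrightarrow> S i ` U \<inter> S j ` U = {}"
  using strong by (auto simp: strong_feasible_open_set_def feasible_open_set_def)

lemma continuous_S: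
  assumes "i \<in> {1..N}" shows "continuous_on A (S i)"
  by (rule lipschitz_on_continuous_on[of "r i"])
    (use ratio[OF assms] in \<open>auto simp: less_imp_le intro!: lipschitz_onI\<close>)

lemma inj_S: "i \<in> {1..N} \<Longrightarrow> inj (S i)"
  using ratio by (intro injI) (metis dist_eq_0_iff less_irrefl mult_eq_0_iff)

lemma open_S_U:
  assumes "i \<in> {1..N}" shows "open (S i ` U)"
  using continuous_S[OF assms] open_U inj_S[OF assms] inj_on_subset
  by (blast intro: invariance_of_domain)

lemma compact_closure_U: "compact (closure U)"
  using bounded_U by (simp add: compact_closure)

lemma closure_S_U:
  assumes "i \<in> {1..N}" shows "closure (S i ` U) = S i ` closure U"
proof (rule closure_unique)
  show "S i ` U \<subseteq> S i ` closure U" using closure_subset by blast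
  show "closed (S i ` closure U)"
    using assms by (intro compact_imp_closed compact_continuous_image continuous_S compact_closure_U)
  fix T assume "S i ` U \<subseteq> T" "closed T"
  then show "S i ` closure U \<subseteq> T"
    using assms by (intro image_closure_subset continuous_S)
qed

lemma frontier_U_eq: "frontier U = closure U - U"
  using open_U by (simp add: frontier_def interior_open)

lemma frontier_U_nonempty: "frontier U \<noteq> {}"
  using U_nonempty bounded_U by (intro frontier_not_empty) auto

lemma frontier_S_U:
  assumes "i \<in> {1..N}" shows "frontier (S i ` U) \<subseteq> S i ` F"
  using frontier_U frontier_U_eq open_S_U[OF assms] closure_S_U[OF assms]
  by (auto simp: frontier_def[of "S i ` U"] interior_open)

lemma S_closure_U_subset:
  assumes "i \<in> {1..N}" shows "S i ` closure U \<subseteq> closure U"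
  using closure_S_U[OF assms] closure_mono[OF S_U_subset[OF assms]] by simp

lemma max_ratio:
  obtains q where "0 < q" "q < 1" "\<And>i. i \<in> {1..N} \<Longrightarrow> r i \<le> q"
proof
  define q where "q = Max (r ` {1..N})"
  have "q \<in> r ` {1..N}" unfolding q_def using N_ge_2 by (intro Max_in) auto
  then show "0 < q" "q < 1" using ratio by auto
  show "r i \<le> q" if "i \<in> {1..N}" for i using that by (auto simp: q_def)
qed

lemma infdist_S_le:
  assumes i: "i \<in> {1..N}" and A: "closed A" "A \<noteq> {}" "S i ` A \<subseteq> A"
  shows "infdist (S i x) A \<le> r i * infdist x A"
  using infdist_mono[OF A(3), of "S i x"] infdist_similarity_image[OF A(1) ratio(1,3)[OF i], of x] A(2)
  by simp

text \<open>A point \<open>S i z\<close> of \<open>F\<close> is closer to \<open>closure U\<close> than its preimage \<open>z\<close> in \<open>F\<close> by the factor \<open>r i\<close>,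
  so \<open>descent_bound\<close> applies to the distance.\<close>

lemma F_subset_closure_U: "F \<subseteq> closure U"
proof
  fix x assume x: "x \<in> F"
  obtain q where q: "0 < q" "q < 1" "\<And>i. i \<in> {1..N} \<Longrightarrow> r i \<le> q" by (rule max_ratio) blast
  have ne: "closure U \<noteq> {}" using U_nonempty by simp
  obtain C where C: "\<And>y. y \<in> F \<Longrightarrow> infdist y (closure U) \<le> C"
  proof -
    have "compact ((\<lambda>y. infdist y (closure U)) ` F)"
      by (intro compact_continuous_image continuous_intros compact_F)
    then have "bounded ((\<lambda>y. infdist y (closure U)) ` F)" by (rule compact_imp_bounded)
    then show ?thesis using that unfolding bounded_iff by (metis abs_le_D1 image_eqI real_norm_def)
  qed
  have "infdist x (closure U) \<le> 0"
  proof (rule descent_bound[OF _ q(2) order_refl C _ x])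
    fix y assume "y \<in> F"
    then obtain i z where i: "i \<in> {1..N}" "z \<in> F" "y = S i z" using F_eq by blast
    have "infdist y (closure U) \<le> r i * infdist z (closure U)"
      unfolding i(3) using ne S_closure_U_subset[OF i(1)] by (intro infdist_S_le[OF i(1)]) auto
    also have "\<dots> \<le> q * infdist z (closure U)"
      using q(3)[OF i(1)] by (intro mult_right_mono infdist_nonneg)
    finally show "infdist y (closure U) \<le> 0 \<or> (\<exists>z\<in>F. infdist y (closure U) \<le> q * infdist z (closure U))"
      using i by blast
  qed (use q in auto)
  then have "infdist x (closure U) = 0" using infdist_nonneg[of x "closure U"] by linarith
  then show "x \<in> closure U" using in_closed_iff_infdist_zero[of "closure U" x] ne by simp
qed

text \<open>Outside \<open>G\<close> and \<open>F\<close>, a point of \<open>closure U\<close> is the image of another one whose distance from \<open>F\<close>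
  is larger by at least a fixed factor. So the distance from \<open>F\<close> is controlled by its values on the
  generator. With \<open>g = 0\<close> the bound shows that an empty generator is only possible if \<open>U \<subseteq> F\<close>.\<close>

lemma infdist_F_bound:
  assumes g: "0 \<le> g" and G: "\<And>x. x \<in> generator N S U \<Longrightarrow> infdist x F \<le> g"
    and x: "x \<in> closure U"
  shows "infdist x F \<le> g"
proof -
  obtain q where q: "0 < q" "q < 1" "\<And>i. i \<in> {1..N} \<Longrightarrow> r i \<le> q" by (rule max_ratio) blast
  obtain C where C: "\<And>y. y \<in> closure U \<Longrightarrow> infdist y F \<le> C"
  proof -
    have "compact ((\<lambda>y. infdist y F) ` closure U)"
      by (intro compact_continuous_image continuous_intros compact_closure_U)
    then have "bounded ((\<lambda>y. infdist y F) ` closure U)" by (rule compact_imp_bounded)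
    then show ?thesis using that unfolding bounded_iff by (metis abs_le_D1 image_eqI real_norm_def)
  qed
  show ?thesis
  proof (rule descent_bound[OF _ q(2) g C _ x])
    fix y assume y: "y \<in> closure U"
    consider "y \<in> F" | "y \<in> generator N S U" | "y \<in> hutchinson N S (closure U)"
      using y frontier_U frontier_U_eq by (auto simp: generator_def)
    then show "infdist y F \<le> g \<or> (\<exists>z\<in>closure U. infdist y F \<le> q * infdist z F)"
    proof cases
      case 3
      then obtain i z where i: "i \<in> {1..N}" "z \<in> closure U" "y = S i z"
        by (auto simp: hutchinson_def)
      have "infdist y F \<le> r i * infdist z F"
        unfolding i(3) using F_nonempty S_F_subset[OF i(1)] closed_F by (intro infdist_S_le[OF i(1)])
      also have "\<dots> \<le> q * infdist z F"
        using q(3)[OF i(1)] by (intro mult_right_mono infdist_nonneg)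
      finally show ?thesis using i by blast
    qed (use g G in auto)
  qed (use q in auto)
qed

abbreviation G :: "'a set" where "G \<equiv> generator N S U"

lemma closed_hutchinson_closure_U: "closed (hutchinson N S (closure U))"
  unfolding hutchinson_def
  by (intro compact_imp_closed compact_UN compact_continuous_image continuous_S compact_closure_U) auto

lemma open_G: "open G"
  using open_U closed_hutchinson_closure_U by (auto simp: generator_def)

lemma bounded_G: "bounded G"
  using bounded_U by (rule bounded_subset) (auto simp: generator_def)

lemma G_disjoint_S_U: "i \<in> {1..N} \<Longrightarrow> G \<inter> S i ` U = {}"
  using closure_subset[of U] by (fastforce simp: generator_def hutchinson_def)

lemma G_disjoint_F: "G \<inter> F = {}"
  using F_eq F_subset_closure_U by (fastforce simp: generator_def hutchinson_def)

lemma frontier_G: "frontier G \<subseteq> F"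
  using compatible_tiling_iff_frontier_subset[OF ifs self_similar] strong frontier_U
  by (auto simp: compatible_tiling_def strong_feasible_open_set_def)

lemma frontier_G_nonempty:
  assumes "G \<noteq> {}" shows "frontier G \<noteq> {}"
  using assms bounded_G by (intro frontier_not_empty) auto

lemma infdist_frontier_G:
  assumes "x \<in> G" shows "infdist x (frontier G) = infdist x F"
proof -
  have "frontier G \<noteq> {}" using assms by (intro frontier_G_nonempty) auto
  moreover have "F \<inter> G \<subseteq> frontier G" using G_disjoint_F by blast
  ultimately show ?thesis
    using infdist_eq_of_frontier_subset[OF closed_F frontier_G _ order_refl _ assms] by simp
qed

lemma infdist_S_U:
  assumes i: "i \<in> {1..N}" and x: "x \<in> U"
  shows "infdist (S i x) F = r i * infdist x F"
proof -
  have "F \<inter> S i ` U \<subseteq> S i ` F"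
  proof
    fix y assume y: "y \<in> F \<inter> S i ` U"
    then obtain j where j: "j \<in> {1..N}" "y \<in> S j ` F" using F_eq by blast
    show "y \<in> S i ` F"
    proof (cases "j = i")
      case False
      then have "S i ` U \<inter> closure (S j ` U) = {}"
        using S_U_disjoint[OF i j(1)] open_S_U[OF i] by (simp add: open_Int_closure_eq_empty)
      moreover have "y \<in> closure (S j ` U)"
        using j F_subset_closure_U closure_S_U[OF j(1)] by blast
      ultimately show ?thesis using y by blast
    qed (use j in simp)
  qed
  then have "infdist (S i x) F = infdist (S i x) (S i ` F)"
    using x F_nonempty
    by (intro infdist_eq_of_frontier_subset[OF closed_F S_F_subset[OF i] _ frontier_S_U[OF i]]) auto
  then show ?thesis
    using infdist_similarity_image[OF closed_F ratio(1,3)[OF i], of x] by simp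
qed

text \<open>Up to subsets of \<open>F\<close>, the set \<open>U\<close> is the disjoint union of the generator and the
  images of \<open>U\<close>.\<close>

lemma U_decomposition: "U - (G \<union> (\<Union>i\<in>{1..N}. S i ` U)) \<subseteq> F"
proof
  fix x assume x: "x \<in> U - (G \<union> (\<Union>i\<in>{1..N}. S i ` U))"
  then obtain i y where i: "i \<in> {1..N}" "y \<in> closure U" "x = S i y"
    by (auto simp: generator_def hutchinson_def)
  then have "y \<in> frontier U" using x by (auto simp: frontier_U_eq)
  then show "x \<in> F" using i S_F_subset[OF i(1)] frontier_U by blast
qed

lemma lmeasurable_U: "U \<in> lmeasurable" and lmeasurable_G: "G \<in> lmeasurable"
  using open_U bounded_U open_G bounded_G by (auto intro: lmeasurable_open)

lemma measure_S_image:
  assumes "i \<in> {1..N}" and "A \<in> lmeasurable"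
  shows "S i ` A \<in> lmeasurable" "measure lebesgue (S i ` A) = r i ^ DIM('a) * measure lebesgue A"
proof -
  have "A \<in> sets lebesgue" using assms by auto
  then show "measure lebesgue (S i ` A) = r i ^ DIM('a) * measure lebesgue A"
    using ratio[OF assms(1)] by (intro measure_similarity_image)
  have "emeasure lebesgue (S i ` A) \<le> ennreal (r i ^ DIM('a)) * emeasure lebesgue A"
    using ratio[OF assms(1)] \<open>A \<in> sets lebesgue\<close> by (intro emeasure_lipschitz_image_le) auto
  also have "\<dots> < \<infinity>"
    using assms(2) by (simp add: ennreal_mult_less_top fmeasurable_def del: emeasure_completion)
  finally show "S i ` A \<in> lmeasurable"
    using ratio[OF assms(1)] \<open>A \<in> sets lebesgue\<close>
    by (intro fmeasurableI measure_similarity_image(1)) auto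
qed

lemma measure_disjoint_pieces:
  assumes A: "A \<in> lmeasurable" "A \<subseteq> G"
    and B: "\<And>i. i \<in> {1..N} \<Longrightarrow> B i \<in> lmeasurable" "\<And>i. i \<in> {1..N} \<Longrightarrow> B i \<subseteq> U"
  shows "A \<union> (\<Union>i\<in>{1..N}. S i ` B i) \<in> lmeasurable"
    and "measure lebesgue (A \<union> (\<Union>i\<in>{1..N}. S i ` B i)) =
      measure lebesgue A + (\<Sum>i\<in>{1..N}. r i ^ DIM('a) * measure lebesgue (B i))"
proof -
  have SB: "S i ` B i \<in> lmeasurable" if "i \<in> {1..N}" for i
    using measure_S_image(1)[OF that B(1)[OF that]] .
  then have UB: "(\<Union>i\<in>{1..N}. S i ` B i) \<in> lmeasurable"
    by (intro fmeasurable.finite_UN) auto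
  then show "A \<union> (\<Union>i\<in>{1..N}. S i ` B i) \<in> lmeasurable" using A by (intro fmeasurable.Un)
  have sub: "S i ` B i \<subseteq> S i ` U" if "i \<in> {1..N}" for i using B(2)[OF that] by auto
  have "measure lebesgue (A \<union> (\<Union>i\<in>{1..N}. S i ` B i)) =
      measure lebesgue A + measure lebesgue (\<Union>i\<in>{1..N}. S i ` B i)"
  proof (rule measure_Un_disjoint_lmeasurable)
    show "A \<inter> (\<Union>i\<in>{1..N}. S i ` B i) = {}"
      using A sub G_disjoint_S_U by blast
  qed (use A UB in auto)
  also have "measure lebesgue (\<Union>i\<in>{1..N}. S i ` B i) = (\<Sum>i\<in>{1..N}. measure lebesgue (S i ` B i))"
  proof (rule measure_finite_Union)
    show "disjoint_family_on (\<lambda>i. S i ` B i) {1..N}"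
      unfolding disjoint_family_on_def using sub S_U_disjoint by blast
    show "emeasure lebesgue (S i ` B i) \<noteq> \<infinity>" if "i \<in> {1..N}" for i
      using SB[OF that] by (auto simp: fmeasurable_def)
  qed (use SB in auto)
  also have "\<dots> = (\<Sum>i\<in>{1..N}. r i ^ DIM('a) * measure lebesgue (B i))"
    using measure_S_image(2) B(1) by simp
  finally show "measure lebesgue (A \<union> (\<Union>i\<in>{1..N}. S i ` B i)) =
      measure lebesgue A + (\<Sum>i\<in>{1..N}. r i ^ DIM('a) * measure lebesgue (B i))" .
qed

lemma measure_U_pos: "0 < measure lebesgue U"
  using open_not_negligible[OF open_U U_nonempty] lmeasurable_U
  by (simp add: negligible_iff_measure zero_less_measure_iff)

lemma volume_deficit:
  "measure lebesgue G \<le> (1 - (\<Sum>i\<in>{1..N}. r i ^ DIM('a))) * measure lebesgue U"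
proof -
  have "G \<union> (\<Union>i\<in>{1..N}. S i ` U) \<subseteq> U"
    unfolding generator_def using S_U_subset by blast
  then have "measure lebesgue (G \<union> (\<Union>i\<in>{1..N}. S i ` U)) \<le> measure lebesgue U"
    using measure_disjoint_pieces(1)[of G "\<lambda>_. U"] lmeasurable_G lmeasurable_U
    by (intro measure_mono_fmeasurable) (auto dest: fmeasurableD)
  then show ?thesis
    using measure_disjoint_pieces(2)[of G "\<lambda>_. U"] lmeasurable_G lmeasurable_U
    by (simp add: sum_distrib_right left_diff_distrib)
qed

definition volume_in_U :: "real \<Rightarrow> real" where
  "volume_in_U \<epsilon> = measure lebesgue {x \<in> U. infdist x F \<le> \<epsilon>}"

lemma lmeasurable_inside: "{x \<in> U. infdist x F \<le> \<epsilon>} \<in> lmeasurable"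
proof -
  have "{x \<in> U. infdist x F \<le> \<epsilon>} = U \<inter> parallel_set F \<epsilon>" by (auto simp: parallel_set_def)
  then show ?thesis
    using lmeasurable_U parallel_set_lmeasurable[OF compact_F F_nonempty]
    by (auto intro: fmeasurable_Int_fmeasurable)
qed

lemma volume_in_U_mono: "\<delta> \<le> \<epsilon> \<Longrightarrow> volume_in_U \<delta> \<le> volume_in_U \<epsilon>"
  unfolding volume_in_U_def using lmeasurable_inside
  by (intro measure_mono_fmeasurable) auto

lemma volume_in_U_nonneg: "0 \<le> volume_in_U \<epsilon>" by (simp add: volume_in_U_def)

lemma volume_in_U_le: "volume_in_U \<epsilon> \<le> measure lebesgue U"
  unfolding volume_in_U_def using lmeasurable_inside lmeasurable_U
  by (intro measure_mono_fmeasurable) auto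

lemma volume_in_U_pos:
  assumes "0 < \<epsilon>" shows "0 < volume_in_U \<epsilon>"
proof -
  obtain x where x: "x \<in> U" "x \<in> F" using U_F by blast
  have op: "open {x \<in> U. infdist x F < \<epsilon>}"
    using open_U by (auto simp: Collect_conj_eq intro!: open_Int open_Collect_less continuous_intros)
  have "{x \<in> U. infdist x F < \<epsilon>} \<noteq> {}" using x assms by auto
  then have "\<not> negligible {x \<in> U. infdist x F < \<epsilon>}" using op by (intro open_not_negligible)
  then have "\<not> negligible {x \<in> U. infdist x F \<le> \<epsilon>}"
    by (rule contrapos_nn) (auto elim: negligible_subset)
  then show ?thesis
    using lmeasurable_inside by (simp add: volume_in_U_def negligible_iff_measure zero_less_measure_iff)
qed

text \<open>On each piece of the decomposition of \<open>U\<close>, the distance from \<open>F\<close> depends on that piece alone: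
  it is the distance from \<open>frontier G\<close> on the generator, and a scaled copy of the distance function
  on \<open>U\<close> on each image of \<open>U\<close>. So the volumes add up without error terms.\<close>

lemma volume_renewal:
  assumes null: "negligible F"
  shows "volume_in_U \<epsilon> = inner_parallel_volume G \<epsilon> +
    (\<Sum>i\<in>{1..N}. r i ^ DIM('a) * volume_in_U (\<epsilon> / r i))"
proof -
  define A where "A = {x \<in> G. infdist x (frontier G) \<le> \<epsilon>}"
  define B where "B i = {x \<in> U. infdist x F \<le> \<epsilon> / r i}" for i
  define E where "E = {x \<in> U. infdist x F \<le> \<epsilon>}"
  have A_eq: "A = G \<inter> parallel_set F \<epsilon>"
    using infdist_frontier_G by (auto simp: A_def parallel_set_def)
  then have A: "A \<in> lmeasurable" "A \<subseteq> G"
    using lmeasurable_G parallel_set_lmeasurable[OF compact_F F_nonempty] by auto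
  have B: "B i \<in> lmeasurable" "B i \<subseteq> U" for i
    unfolding B_def using lmeasurable_inside by auto
  have SB: "S i ` B i = E \<inter> S i ` U" if "i \<in> {1..N}" for i
    using infdist_S_U[OF that] ratio(1)[OF that] S_U_subset[OF that]
    by (auto simp: B_def E_def field_simps image_iff)
  have A_E: "A = E \<inter> G"
    unfolding A_eq E_def by (auto simp: parallel_set_def generator_def)
  define X where "X = A \<union> (\<Union>i\<in>{1..N}. S i ` B i)"
  have UB: "(\<Union>i\<in>{1..N}. S i ` B i) = E \<inter> (\<Union>i\<in>{1..N}. S i ` U)"
    unfolding Int_UN_distrib by (rule SUP_cong[OF refl SB])
  have X_eq: "X = E \<inter> (G \<union> (\<Union>i\<in>{1..N}. S i ` U))"
    unfolding X_def UB A_E Int_Un_distrib ..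
  have "E \<subseteq> U" by (auto simp: E_def)
  then have "X - E \<union> (E - X) \<subseteq> F" using U_decomposition unfolding X_eq by blast
  then have "negligible (X - E \<union> (E - X))" by (rule negligible_subset[OF null])
  moreover have "X \<in> lmeasurable" unfolding X_def by (rule measure_disjoint_pieces(1)[OF A B])
  ultimately have "measure lebesgue E = measure lebesgue X"
    by (rule measure_negligible_symdiff[rotated])
  then show ?thesis
    using measure_disjoint_pieces(2)[OF A B]
    by (simp add: volume_in_U_def inner_parallel_volume_def X_def E_def A_def B_def)
qed

lemma parallel_volume_split:
  "measure lebesgue (parallel_set F \<epsilon>) =
     volume_in_U \<epsilon> + measure lebesgue (parallel_set F \<epsilon> - U)"
proof -
  have "measure lebesgue (parallel_set F \<epsilon>) =
      measure lebesgue ({x \<in> U. infdist x F \<le> \<epsilon>} \<union> (parallel_set F \<epsilon> - U))"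
    by (rule arg_cong[where f = "measure lebesgue"]) (auto simp: parallel_set_def)
  also have "\<dots> = volume_in_U \<epsilon> + measure lebesgue (parallel_set F \<epsilon> - U)"
    unfolding volume_in_U_def
    using lmeasurable_inside lmeasurable_U parallel_set_lmeasurable[OF compact_F F_nonempty]
    by (intro measure_Un_disjoint_lmeasurable) auto
  finally show ?thesis .
qed

text \<open>Outside \<open>U\<close>, the frontier of \<open>U\<close> is as close as \<open>closure U\<close>, which contains \<open>F\<close>.\<close>

lemma parallel_set_outside_subset: "parallel_set F \<epsilon> - U \<subseteq> parallel_set (frontier U) \<epsilon>"
proof
  fix x assume x: "x \<in> parallel_set F \<epsilon> - U"
  have "infdist x (closure U) = infdist x (frontier U)"
    using x frontier_U_nonempty frontier_U_eq
    by (intro infdist_eq_of_frontier_subset[of _ _ "- U"]) (auto simp: frontier_complement)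
  then have "infdist x (frontier U) \<le> infdist x F"
    using F_subset_closure_U F_nonempty by (metis infdist_mono)
  then show "x \<in> parallel_set (frontier U) \<epsilon>" using x by (simp add: parallel_set_def)
qed

end

section \<open>Bounds for dimensions and parallel volumes\<close>

lemma minkowski_dimension_le:
  fixes A :: "'a::euclidean_space set"
  assumes A: "compact A" "A \<noteq> {}" and dim: "has_minkowski_dimension A D"
    and C: "\<And>\<epsilon>. 0 < \<epsilon> \<Longrightarrow> \<epsilon> \<le> 1 \<Longrightarrow>
      measure lebesgue (parallel_set A \<epsilon>) \<le> C * \<epsilon> powr (real DIM('a) - s)"
  shows "D \<le> s"
proof -
  define d where "d = real DIM('a)"
  have pos: "0 < measure lebesgue (parallel_set A \<epsilon>)" if "0 < \<epsilon>" for \<epsilon>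
  proof -
    obtain a where "a \<in> A" using A by blast
    then have "ball a \<epsilon> \<subseteq> parallel_set A \<epsilon>"
      by (auto simp: parallel_set_def dist_commute intro: infdist_le2)
    then have "\<not> negligible (parallel_set A \<epsilon>)"
      using open_not_negligible[of "ball a \<epsilon>"] that negligible_subset by auto
    then show ?thesis
      using parallel_set_lmeasurable[OF A] by (simp add: negligible_iff_measure zero_less_measure_iff)
  qed
  have "C > 0" using pos[of 1] C[of 1] by simp
  have ev: "\<forall>\<^sub>F \<epsilon> in at_right 0. d - ln (measure lebesgue (parallel_set A \<epsilon>)) / ln \<epsilon> \<le> s - ln C / ln \<epsilon>"
  proof -
    have "\<forall>\<^sub>F \<epsilon>::real in at_right 0. \<epsilon> \<in> {0<..<1}" by (rule eventually_at_right_real) simp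
    then show ?thesis
    proof eventually_elim
      case (elim \<epsilon>)
      then have l: "ln \<epsilon> < 0" by simp
      have "ln (measure lebesgue (parallel_set A \<epsilon>)) \<le> ln (C * \<epsilon> powr (d - s))"
        using pos C elim \<open>C > 0\<close> by (simp add: d_def)
      also have "\<dots> = ln C + (d - s) * ln \<epsilon>"
        using \<open>C > 0\<close> elim by (simp add: ln_mult ln_powr)
      finally have "(ln C + (d - s) * ln \<epsilon>) / ln \<epsilon> \<le> ln (measure lebesgue (parallel_set A \<epsilon>)) / ln \<epsilon>"
        using l by (intro divide_right_mono_neg) auto
      then show ?case using l by (simp add: add_divide_distrib)
    qed
  qed
  have "((\<lambda>\<epsilon>. s - ln C / ln \<epsilon>) \<longlongrightarrow> s - 0) (at_right 0)"
    by (intro tendsto_diff tendsto_const tendsto_divide_0[OF tendsto_const])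
      (rule filterlim_at_bot_imp_at_infinity[OF ln_at_0])
  moreover have "((\<lambda>\<epsilon>. d - ln (measure lebesgue (parallel_set A \<epsilon>)) / ln \<epsilon>) \<longlongrightarrow> D) (at_right 0)"
    using dim by (simp add: has_minkowski_dimension_def d_def)
  ultimately have "D \<le> s - 0" using ev by (intro tendsto_le[of "at_right 0"]) auto
  then show ?thesis by simp
qed

lemma minkowski_dimension_not_negligible:
  fixes A :: "'a::euclidean_space set"
  assumes A: "compact A" "A \<noteq> {}" and dim: "has_minkowski_dimension A D"
    and nn: "\<not> negligible A"
  shows "D = real DIM('a)"
proof -
  define V where "V \<epsilon> = measure lebesgue (parallel_set A \<epsilon>)" for \<epsilon>
  define m where "m = measure lebesgue A"
  have AM: "A \<in> lmeasurable" using A by (intro lmeasurable_compact)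
  then have m: "0 < m" using nn by (simp add: m_def negligible_iff_measure zero_less_measure_iff)
  have meas: "parallel_set A \<epsilon> \<in> lmeasurable" for \<epsilon> using A by (rule parallel_set_lmeasurable)
  have V: "m \<le> V \<epsilon>" "V \<epsilon> \<le> V 1" if \<epsilon>: "0 < \<epsilon>" "\<epsilon> \<le> 1" for \<epsilon>
  proof -
    show "m \<le> V \<epsilon>" unfolding m_def V_def
      using subset_parallel_set[of \<epsilon> A] \<epsilon> fmeasurableD[OF AM] meas
      by (intro measure_mono_fmeasurable) simp_all
    show "V \<epsilon> \<le> V 1" unfolding V_def
      using parallel_set_mono[OF \<epsilon>(2)] fmeasurableD[OF meas] meas by (intro measure_mono_fmeasurable)
  qed
  define B where "B = max \<bar>ln m\<bar> \<bar>ln (V 1)\<bar>"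
  have "((\<lambda>\<epsilon>. ln (V \<epsilon>) / ln \<epsilon>) \<longlongrightarrow> 0) (at_right 0)"
  proof (rule tendsto_0_le[where K = 1])
    show "((\<lambda>\<epsilon>. B / ln \<epsilon>) \<longlongrightarrow> 0) (at_right 0)"
      by (intro tendsto_divide_0[OF tendsto_const] filterlim_at_bot_imp_at_infinity[OF ln_at_0])
    have "\<forall>\<^sub>F \<epsilon>::real in at_right 0. \<epsilon> \<in> {0<..<1}" by (rule eventually_at_right_real) simp
    then show "\<forall>\<^sub>F \<epsilon> in at_right 0. norm (ln (V \<epsilon>) / ln \<epsilon>) \<le> norm (B / ln \<epsilon>) * 1"
    proof eventually_elim
      case (elim \<epsilon>)
      then have "ln m \<le> ln (V \<epsilon>)" "ln (V \<epsilon>) \<le> ln (V 1)" using V[of \<epsilon>] m by auto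
      then have "\<bar>ln (V \<epsilon>)\<bar> \<le> B" by (auto simp: B_def)
      moreover have "0 \<le> B" by (simp add: B_def)
      ultimately show ?case by (simp add: divide_right_mono)
    qed
  qed
  then have "((\<lambda>\<epsilon>. real DIM('a) - ln (V \<epsilon>) / ln \<epsilon>) \<longlongrightarrow> real DIM('a) - 0) (at_right 0)"
    by (intro tendsto_diff tendsto_const)
  moreover have "((\<lambda>\<epsilon>. real DIM('a) - ln (V \<epsilon>) / ln \<epsilon>) \<longlongrightarrow> D) (at_right 0)"
    using dim by (simp add: has_minkowski_dimension_def V_def)
  ultimately have "D = real DIM('a) - 0" by (intro tendsto_unique[of "at_right 0"]) auto
  then show ?thesis by simp
qed

context compatible_ifs
begin

subsection \<open>Iterates of the function system\<close>

definition words :: "nat \<Rightarrow> nat list set" where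
  "words n = {xs. set xs \<subseteq> {1..N} \<and> length xs = n}"

definition word_map :: "nat list \<Rightarrow> 'a \<Rightarrow> 'a" where
  "word_map xs = foldr (\<lambda>i f. S i \<circ> f) xs id"

definition word_ratio :: "nat list \<Rightarrow> real" where
  "word_ratio xs = prod_list (map r xs)"

lemma word_map_simps [simp]:
  "word_map [] = id" "word_map (i # xs) = S i \<circ> word_map xs"
  and word_ratio_simps [simp]:
  "word_ratio [] = 1" "word_ratio (i # xs) = r i * word_ratio xs"
  by (simp_all add: word_map_def word_ratio_def)

lemma finite_words: "finite (words n)"
  unfolding words_def by (rule finite_lists_length_eq) simp

lemma words_Suc: "words (Suc n) = (\<lambda>(i, xs). i # xs) ` ({1..N} \<times> words n)"
  by (auto simp: words_def length_Suc_conv image_iff)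

lemma word_ratio_pos: "set xs \<subseteq> {1..N} \<Longrightarrow> 0 < word_ratio xs"
  by (induction xs) (auto simp: ratio)

lemma word_map_similarity:
  "set xs \<subseteq> {1..N} \<Longrightarrow> dist (word_map xs x) (word_map xs y) = word_ratio xs * dist x y"
  by (induction xs) (auto simp: ratio)

lemma word_map_U_subset: "set xs \<subseteq> {1..N} \<Longrightarrow> word_map xs ` U \<subseteq> U"
proof (induction xs)
  case (Cons i xs)
  then have "word_map xs ` U \<subseteq> U" "S i ` U \<subseteq> U" using S_U_subset[of i] by auto
  then show ?case unfolding word_map_simps by (auto simp: image_subset_iff)
qed simp

lemma F_eq_words: "F = (\<Union>xs\<in>words n. word_map xs ` F)"
proof (induction n)
  case 0
  then show ?case by (simp add: words_def)
next
  case (Suc n)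
  have "F = (\<Union>i\<in>{1..N}. S i ` (\<Union>xs\<in>words n. word_map xs ` F))"
    using F_eq Suc.IH by simp
  also have "\<dots> = (\<Union>xs\<in>words (Suc n). word_map xs ` F)"
    unfolding words_Suc by (auto simp: image_iff) fastforce+
  finally show ?case .
qed

lemma sum_words_ratio_powr:
  assumes "(\<Sum>i\<in>{1..N}. r i powr s) = 1"
  shows "(\<Sum>xs\<in>words n. word_ratio xs powr s) = 1"
proof (induction n)
  case 0
  have "words 0 = {[]}" by (auto simp: words_def)
  then show ?case by simp
next
  case (Suc n)
  have "(\<Sum>xs\<in>words (Suc n). word_ratio xs powr s) =
      (\<Sum>(i, xs)\<in>{1..N} \<times> words n. (r i * word_ratio xs) powr s)"
    unfolding words_Suc by (subst sum.reindex) (auto simp: inj_on_def intro!: sum.cong)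
  also have "\<dots> = (\<Sum>(i, xs)\<in>{1..N} \<times> words n. r i powr s * word_ratio xs powr s)"
  proof (rule sum.cong[OF refl], clarify)
    fix i xs assume "i \<in> {1..N}" "xs \<in> words n"
    then have "0 < r i" "0 < word_ratio xs" using ratio word_ratio_pos by (auto simp: words_def)
    then show "(r i * word_ratio xs) powr s = r i powr s * word_ratio xs powr s"
      by (simp add: powr_mult)
  qed
  also have "\<dots> = (\<Sum>i\<in>{1..N}. r i powr s) * (\<Sum>xs\<in>words n. word_ratio xs powr s)"
    by (simp add: sum_product sum.cartesian_product)
  finally show ?case using assms Suc.IH by simp
qed

lemma word_ratio_le:
  assumes "set xs \<subseteq> {1..N}" "\<And>i. i \<in> {1..N} \<Longrightarrow> r i \<le> q"
  shows "word_ratio xs \<le> q ^ length xs"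
  using assms(1)
proof (induction xs)
  case (Cons i xs)
  then have "0 < r i" "r i \<le> q" "0 < word_ratio xs" "word_ratio xs \<le> q ^ length xs"
    using ratio assms(2) word_ratio_pos[of xs] by auto
  then show ?case by (auto intro!: mult_mono)
qed simp

text \<open>Since \<open>U\<close> meets \<open>F\<close>, a sufficiently small copy of \<open>F\<close> lies inside \<open>U\<close>.\<close>

lemma small_copy_inside_U:
  obtains xs where "xs \<in> words (length xs)" "xs \<noteq> []" "word_map xs ` F \<subseteq> U"
proof -
  obtain x where x: "x \<in> U" "x \<in> F" using U_F by blast
  obtain \<delta> where \<delta>: "0 < \<delta>" "ball x \<delta> \<subseteq> U" using open_U x by (meson openE)
  obtain q where q: "0 < q" "q < 1" "\<And>i. i \<in> {1..N} \<Longrightarrow> r i \<le> q" by (rule max_ratio) blast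
  obtain K where K: "0 < K" "\<And>y z. y \<in> F \<Longrightarrow> z \<in> F \<Longrightarrow> dist y z \<le> K"
  proof -
    have "bounded F" using compact_F by (rule compact_imp_bounded)
    then have "dist y z \<le> max 1 (diameter F)" if "y \<in> F" "z \<in> F" for y z
      using diameter_bounded_bound[OF _ that] by auto
    then show ?thesis using that[of "max 1 (diameter F)"] by auto
  qed
  obtain n where n: "q ^ n < \<delta> / K" using real_arch_pow_inv[of "\<delta> / K" q] \<delta> K q by auto
  have n': "q ^ Suc n * K < \<delta>"
  proof -
    have "q ^ Suc n \<le> q ^ n" using q by (simp add: mult_left_le_one_le)
    then have "q ^ Suc n < \<delta> / K" using n by linarith
    then show ?thesis using K by (simp add: field_simps)
  qed
  obtain xs where xs: "xs \<in> words (Suc n)" "x \<in> word_map xs ` F"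
    using x F_eq_words[of "Suc n"] by blast
  then have xs': "set xs \<subseteq> {1..N}" "length xs = Suc n" by (auto simp: words_def)
  obtain y where y: "y \<in> F" "x = word_map xs y" using xs by blast
  have "word_map xs ` F \<subseteq> U"
  proof
    fix w assume "w \<in> word_map xs ` F"
    then obtain z where z: "z \<in> F" "w = word_map xs z" by blast
    have "dist x w = word_ratio xs * dist y z" using y z word_map_similarity[OF xs'(1)] by simp
    also have "\<dots> \<le> q ^ Suc n * K"
      using word_ratio_le[OF xs'(1) q(3)] xs'(2) K(2)[OF y(1) z(1)] q word_ratio_pos[OF xs'(1)]
      by (intro mult_mono) auto
    finally have "w \<in> ball x \<delta>" using n' by simp
    then show "w \<in> U" using \<delta> by blast
  qed
  moreover have "xs \<in> words (length xs)" "xs \<noteq> []" using xs(1) xs'(2) by auto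
  ultimately show ?thesis using that by blast
qed

text \<open>A point of \<open>frontier U\<close> is not in the copy of \<open>F\<close> inside \<open>U\<close>, and its preimage under any other
  word of the same length is in \<open>F\<close> but not in \<open>U\<close>, hence again in \<open>frontier U\<close>. So \<open>frontier U\<close> is
  covered by its own images under the iterated system without that one word, for which the sum of
  the powers of the ratios is below one at \<open>s\<close>, hence also at some exponent \<open>s' < s\<close>.\<close>

lemma frontier_U_parallel_volume:
  assumes s: "(\<Sum>i\<in>{1..N}. r i powr s) = 1"
  obtains s' C where "s' < s" "0 \<le> C"
    "\<And>\<epsilon>. 0 < \<epsilon> \<Longrightarrow> \<epsilon> \<le> 1 \<Longrightarrow>
      measure lebesgue (parallel_set (frontier U) \<epsilon>) \<le> C * \<epsilon> powr (real DIM('a) - s')"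
proof -
  obtain \<sigma> where \<sigma>: "\<sigma> \<in> words (length \<sigma>)" "\<sigma> \<noteq> []" "word_map \<sigma> ` F \<subseteq> U"
    by (rule small_copy_inside_U)
  define I where "I = words (length \<sigma>) - {\<sigma>}"
  have fin: "finite I" using finite_words by (simp add: I_def)
  have I: "set xs \<subseteq> {1..N}" "length xs = length \<sigma>" if "xs \<in> I" for xs
    using that by (auto simp: I_def words_def)
  have pos: "0 < word_ratio xs" if "xs \<in> I" for xs using word_ratio_pos I that by blast
  obtain q where q: "0 < q" "q < 1" "\<And>i. i \<in> {1..N} \<Longrightarrow> r i \<le> q" by (rule max_ratio) blast
  have less1: "word_ratio xs < 1" if "xs \<in> I" for xs
  proof -
    have "word_ratio xs \<le> q ^ length \<sigma>" using word_ratio_le[of xs q] I[OF that] q by auto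
    also have "\<dots> < 1" using q \<sigma>(2) by (simp add: power_less_one_iff)
    finally show ?thesis .
  qed
  have \<sigma>pos: "0 < word_ratio \<sigma>" using \<sigma>(1) by (intro word_ratio_pos) (auto simp: words_def)
  have "(\<Sum>xs\<in>I. word_ratio xs powr s) = 1 - word_ratio \<sigma> powr s"
    using sum_words_ratio_powr[OF s, of "length \<sigma>"] finite_words \<sigma>(1)
    by (simp add: I_def sum_diff1)
  then have lt: "(\<Sum>xs\<in>I. word_ratio xs powr s) < 1" using \<sigma>pos by simp
  have "((\<lambda>t. \<Sum>xs\<in>I. word_ratio xs powr t) \<longlongrightarrow> (\<Sum>xs\<in>I. word_ratio xs powr s)) (at_left s)"
    by (intro tendsto_sum tendsto_powr tendsto_const tendsto_ident_at) (metis pos less_irrefl)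
  then have "\<forall>\<^sub>F t in at_left s. (\<Sum>xs\<in>I. word_ratio xs powr t) < 1"
    using lt by (rule order_tendstoD(2))
  moreover have "\<forall>\<^sub>F t in at_left s. t < s" by (simp add: eventually_at_filter)
  ultimately have "\<forall>\<^sub>F t in at_left s. (\<Sum>xs\<in>I. word_ratio xs powr t) < 1 \<and> t < s"
    by (rule eventually_conj)
  then obtain s' where s': "(\<Sum>xs\<in>I. word_ratio xs powr s') < 1" "s' < s"
    using eventually_happens'[OF trivial_limit_at_left_real] by blast
  have cover: "frontier U \<subseteq> (\<Union>xs\<in>I. word_map xs ` frontier U)"
  proof
    fix x assume x: "x \<in> frontier U"
    then have "x \<in> F" "x \<notin> U" using frontier_U frontier_U_eq by auto
    then obtain xs y where xs: "xs \<in> words (length \<sigma>)" "y \<in> F" "x = word_map xs y"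
      using F_eq_words[of "length \<sigma>"] by blast
    have "xs \<in> I" using xs \<sigma>(3) \<open>x \<notin> U\<close> by (auto simp: I_def)
    moreover have "y \<notin> U" using word_map_U_subset[OF I(1)[OF \<open>xs \<in> I\<close>]] xs(3) \<open>x \<notin> U\<close> by blast
    then have "y \<in> frontier U" using xs(2) F_subset_closure_U frontier_U_eq by auto
    ultimately show "x \<in> (\<Union>xs\<in>I. word_map xs ` frontier U)" using xs(3) by blast
  qed
  have fr: "compact (frontier U)" "frontier U \<noteq> {}"
    using bounded_U compact_frontier_bounded frontier_U_nonempty by auto
  obtain C where "0 \<le> C" "\<And>\<epsilon>. 0 < \<epsilon> \<Longrightarrow> \<epsilon> \<le> 1 \<Longrightarrow>
      measure lebesgue (parallel_set (frontier U) \<epsilon>) \<le> C * \<epsilon> powr (real DIM('a) - s')"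
    by (rule parallel_volume_upper_bound[OF fin pos less1 word_map_similarity[OF I(1)] fr cover])
      (use s' in auto)
  with s'(2) that show ?thesis by blast
qed

lemma F_parallel_volume:
  assumes s: "(\<Sum>i\<in>{1..N}. r i powr s) = 1"
  obtains C where "0 \<le> C"
    "\<And>\<epsilon>. 0 < \<epsilon> \<Longrightarrow> \<epsilon> \<le> 1 \<Longrightarrow>
      measure lebesgue (parallel_set F \<epsilon>) \<le> C * \<epsilon> powr (real DIM('a) - s)"
proof (rule parallel_volume_upper_bound[of "{1..N}" r S F s])
  show "F \<subseteq> (\<Union>i\<in>{1..N}. S i ` F)" using F_eq by simp
qed (use ratio compact_F F_nonempty s that in auto)

lemma similarity_dimension_exists:
  obtains s where "0 \<le> s" "s \<le> real DIM('a)" "(\<Sum>i\<in>{1..N}. r i powr s) = 1"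
proof -
  have "0 \<le> (1 - (\<Sum>i\<in>{1..N}. r i ^ DIM('a))) * measure lebesgue U"
    using volume_deficit by (rule order_trans[rotated]) simp
  then have "(\<Sum>i\<in>{1..N}. r i ^ DIM('a)) \<le> 1"
    using measure_U_pos by (simp add: zero_le_mult_iff)
  moreover have "(\<Sum>i\<in>{1..N}. r i powr real DIM('a)) = (\<Sum>i\<in>{1..N}. r i ^ DIM('a))"
    using ratio(1) by (intro sum.cong) (auto simp: powr_realpow)
  ultimately have le: "(\<Sum>i\<in>{1..N}. r i powr real DIM('a)) \<le> 1" by simp
  have "(\<Sum>i\<in>{1..N}. r i powr 0) = (\<Sum>i\<in>{1..N}. 1)"
    using ratio(1) by (intro sum.cong) (auto simp: less_imp_neq[symmetric])
  then have ge: "1 \<le> (\<Sum>i\<in>{1..N}. r i powr 0)" using N_ge_2 by simp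
  have "continuous_on {0..real DIM('a)} (\<lambda>t. \<Sum>i\<in>{1..N}. r i powr t)"
    by (intro continuous_on_sum continuous_on_powr continuous_on_const continuous_on_id)
      (metis ratio(1) less_irrefl)
  then obtain s where "0 \<le> s" "s \<le> real DIM('a)" "(\<Sum>i\<in>{1..N}. r i powr s) = 1"
    using IVT2'[of "\<lambda>t. \<Sum>i\<in>{1..N}. r i powr t", OF le ge] by auto
  with that show ?thesis by blast
qed

lemma G_empty_imp_not_negligible:
  assumes "G = {}" shows "\<not> negligible F"
proof -
  have "U \<subseteq> F"
  proof
    fix x assume "x \<in> U"
    then have "x \<in> closure U" using closure_subset by blast
    then have "infdist x F \<le> 0" using infdist_F_bound[of 0 x] assms by simp
    then have "infdist x F = 0" using infdist_nonneg[of x F] by linarith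
    then show "x \<in> F" using in_closed_iff_infdist_zero[OF closed_F F_nonempty] by simp
  qed
  then show ?thesis using open_not_negligible[OF open_U U_nonempty] negligible_subset by blast
qed

text \<open>If \<open>s\<close> were equal to the dimension of the space, the images of \<open>U\<close> would fill \<open>U\<close> in measure and
  the open generator would be empty. Then \<open>U \<subseteq> F\<close>, and \<open>F\<close> would have full Minkowski dimension.\<close>

lemma similarity_dimension_bounds:
  assumes dim: "has_minkowski_dimension F D" and D: "D < real DIM('a)"
    and s: "s \<le> real DIM('a)" "(\<Sum>i\<in>{1..N}. r i powr s) = 1"
  shows "D \<le> s" "s < real DIM('a)" "negligible F"
proof -
  obtain C where "\<And>\<epsilon>. 0 < \<epsilon> \<Longrightarrow> \<epsilon> \<le> 1 \<Longrightarrow>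
      measure lebesgue (parallel_set F \<epsilon>) \<le> C * \<epsilon> powr (real DIM('a) - s)"
    using F_parallel_volume[OF s(2)] by blast
  then show "D \<le> s" by (rule minkowski_dimension_le[OF compact_F F_nonempty dim])
  show "negligible F"
    using minkowski_dimension_not_negligible[OF compact_F F_nonempty dim] D by auto
  show "s < real DIM('a)"
  proof (rule ccontr)
    assume "\<not> s < real DIM('a)"
    then have "s = real DIM('a)" using s by simp
    then have "(\<Sum>i\<in>{1..N}. r i ^ DIM('a)) = 1"
      using s(2) ratio(1) by (simp add: powr_realpow)
    then have "measure lebesgue G \<le> 0" using volume_deficit by simp
    then have "negligible G" using lmeasurable_G by (simp add: negligible_iff_measure measure_le_0_iff)
    then have "G = {}" using open_not_negligible open_G by blast
    then show False using G_empty_imp_not_negligible \<open>negligible F\<close> by blast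
  qed
qed

end

section \<open>The rescaled volume and the nonlattice case\<close>

lemma filterlim_minus_ln_at_right_0: "filterlim (\<lambda>\<epsilon>::real. - ln \<epsilon>) at_top (at_right 0)"
  using ln_at_0 by (simp add: filterlim_uminus_at_top)

text \<open>Differentiation turns the hypothesis into \<open>\<epsilon> * p' \<epsilon> = a * p \<epsilon>\<close>. This is an identity of polynomials,
  and comparing coefficients gives \<open>(n - a) * coeff p n = 0\<close>, where \<open>a\<close> is not an integer.\<close>

lemma poly_eq_fractional_power_imp_zero:
  fixes p :: "real poly"
  assumes a: "0 < a" "a < 1" and xy: "0 \<le> x" "x < y"
    and eq: "\<And>\<epsilon>. \<epsilon> \<in> {x<..<y} \<Longrightarrow> poly p \<epsilon> = Q * \<epsilon> powr a"
  shows "p = 0"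
proof -
  define q where "q = pCons 0 (pderiv p) - smult a p"
  have "poly q \<epsilon> = 0" if \<epsilon>: "\<epsilon> \<in> {x<..<y}" for \<epsilon>
  proof -
    have "0 < \<epsilon>" using \<epsilon> xy by auto
    then have "((\<lambda>e. Q * e powr a) has_field_derivative Q * (a * \<epsilon> powr (a - 1))) (at \<epsilon>)"
      by (intro DERIV_cmult has_real_derivative_powr)
    then have "(poly p has_field_derivative Q * (a * \<epsilon> powr (a - 1))) (at \<epsilon>)"
      using \<epsilon> eq
      by (subst DERIV_cong_ev[OF refl _ refl, of _ "\<lambda>e. Q * e powr a"])
        (auto intro!: eventually_mono[OF eventually_nhds_in_open[of "{x<..<y}"]])
    then have "poly (pderiv p) \<epsilon> = Q * (a * \<epsilon> powr (a - 1))"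
      by (rule DERIV_unique[OF poly_DERIV])
    moreover have "\<epsilon> * \<epsilon> powr (a - 1) = \<epsilon> powr a"
      using \<open>0 < \<epsilon>\<close> by (simp add: powr_diff)
    ultimately have "\<epsilon> * poly (pderiv p) \<epsilon> = a * poly p \<epsilon>"
      using eq[OF \<epsilon>] by (simp add: mult.left_commute)
    then show ?thesis by (simp add: q_def)
  qed
  then have "{x<..<y} \<subseteq> {\<epsilon>. poly q \<epsilon> = 0}" by blast
  moreover have "infinite {x<..<y}" using xy by simp
  ultimately have "q = 0" using poly_roots_finite finite_subset by blast
  have "coeff p n = 0" for n
  proof -
    have "coeff q n = (real n - a) * coeff p n"
      by (cases n) (simp_all add: q_def coeff_pderiv left_diff_distrib)
    moreover have "real n \<noteq> a" using a by (cases n) auto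
    ultimately show ?thesis using \<open>q = 0\<close> by simp
  qed
  then show ?thesis by (simp add: poly_eq_iff)
qed

locale monophase_ifs = compatible_ifs N S r F U
  for N :: nat and S :: "nat \<Rightarrow> 'a::euclidean_space \<Rightarrow> 'a" and r F U +
  fixes s :: real
  assumes s_sum: "(\<Sum>i\<in>{1..N}. r i powr s) = 1"
    and s_lower: "real DIM('a) - 1 < s" and s_upper: "s < real DIM('a)"
    and null_F: "negligible F" and monophase_G: "monophase G"
begin

definition codim :: real where "codim = real DIM('a) - s"

lemma codim_bounds: "0 < codim" "codim < 1" using s_lower s_upper by (auto simp: codim_def)

lemma G_nonempty: "G \<noteq> {}"
  using G_empty_imp_not_negligible null_F by blast

definition g :: real where "g = inradius G"

lemma infdist_frontier_G_le: "x \<in> G \<Longrightarrow> infdist x (frontier G) \<le> g"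
  unfolding g_def inradius_def
proof (rule cSUP_upper)
  obtain b where b: "b \<in> frontier G" using frontier_G_nonempty[OF G_nonempty] by blast
  obtain e where e: "\<And>x. x \<in> G \<Longrightarrow> dist b x \<le> e"
    using bounded_G bounded_any_center[of G b] by blast
  have "infdist x (frontier G) \<le> e" if "x \<in> G" for x
    using infdist_le[OF b, of x] e[OF that] by (simp add: dist_commute)
  then show "bdd_above ((\<lambda>x. infdist x (frontier G)) ` G)" by (auto intro!: bdd_aboveI)
qed

lemma g_pos: "0 < g"
proof -
  obtain x where x: "x \<in> G" using G_nonempty by blast
  then have "x \<notin> frontier G" using open_G by (simp add: frontier_def interior_open)
  then have "0 < infdist x (frontier G)"
    using frontier_G_nonempty[OF G_nonempty] by (intro infdist_pos_not_in_closed) auto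
  then show ?thesis using infdist_frontier_G_le[OF x] by linarith
qed

lemma volume_in_U_eq_measure_U:
  assumes "g \<le> \<epsilon>" shows "volume_in_U \<epsilon> = measure lebesgue U"
proof -
  have "infdist x F \<le> \<epsilon>" if "x \<in> U" for x
  proof -
    have "infdist x F \<le> g"
    proof (rule infdist_F_bound)
      show "x \<in> closure U" using that closure_subset by blast
      show "infdist y F \<le> g" if "y \<in> G" for y
        using infdist_frontier_G_le[OF that] infdist_frontier_G[OF that] by simp
    qed (use g_pos in simp)
    then show ?thesis using assms by simp
  qed
  then have "{x \<in> U. infdist x F \<le> \<epsilon>} = U" by blast
  then show ?thesis by (simp add: volume_in_U_def)
qed

definition \<kappa> :: "nat \<Rightarrow> real" where
  "\<kappa> = (SOME k. \<forall>\<epsilon>. 0 < \<epsilon> \<and> \<epsilon> \<le> inradius G \<longrightarrow>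
     inner_parallel_volume G \<epsilon> = (\<Sum>i<DIM('a). k i * \<epsilon> ^ (DIM('a) - i)))"

lemma inner_parallel_volume_G:
  assumes "0 < \<epsilon>" "\<epsilon> \<le> g"
  shows "inner_parallel_volume G \<epsilon> = (\<Sum>i<DIM('a). \<kappa> i * \<epsilon> ^ (DIM('a) - i))"
proof -
  have "\<forall>\<epsilon>. 0 < \<epsilon> \<and> \<epsilon> \<le> inradius G \<longrightarrow>
     inner_parallel_volume G \<epsilon> = (\<Sum>i<DIM('a). \<kappa> i * \<epsilon> ^ (DIM('a) - i))"
    unfolding \<kappa>_def using monophase_G unfolding monophase_def by (rule someI_ex)
  then show ?thesis using assms by (simp add: g_def)
qed

definition p :: "nat \<Rightarrow> real" where "p i = r i powr s"
definition \<tau> :: "nat \<Rightarrow> real" where "\<tau> i = - ln (r i)"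

text \<open>In the logarithmic scale \<open>t = - ln \<epsilon>\<close>, these are \<open>\<epsilon> powr (s - d) * v \<epsilon>\<close> and the corresponding
  rescaled inner parallel volume of the generator.\<close>

definition w :: "real \<Rightarrow> real" where "w t = exp (codim * t) * volume_in_U (exp (- t))"
definition z :: "real \<Rightarrow> real" where "z t = exp (codim * t) * inner_parallel_volume G (exp (- t))"

lemma p_pos: "i \<in> {1..N} \<Longrightarrow> 0 < p i"
  using ratio(1) by (simp add: p_def less_imp_neq[symmetric])

lemma p_sum: "(\<Sum>i\<in>{1..N}. p i) = 1" using s_sum by (simp add: p_def)

lemma \<tau>_pos: "i \<in> {1..N} \<Longrightarrow> 0 < \<tau> i"
  using ratio(1,2) by (simp add: \<tau>_def)

lemma w_pos: "0 < w t"
  by (simp add: w_def volume_in_U_pos)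

lemma z_nonneg: "0 \<le> z t"
  by (simp add: z_def inner_parallel_volume_def)

lemma w_renewal: "w t = z t + (\<Sum>i\<in>{1..N}. p i * w (t - \<tau> i))"
proof -
  have "exp (codim * t) * (r i ^ DIM('a) * volume_in_U (exp (- t) / r i)) = p i * w (t - \<tau> i)"
    if i: "i \<in> {1..N}" for i
  proof -
    have r: "0 < r i" using ratio(1)[OF i] .
    have "exp (- (t - \<tau> i)) = exp (- t - ln (r i))" by (simp add: \<tau>_def)
    then have 1: "exp (- (t - \<tau> i)) = exp (- t) / r i" using r by (simp add: exp_diff)
    have "p i * exp (codim * (t - \<tau> i)) = exp (s * ln (r i)) * exp (codim * (t + ln (r i)))"
      using r by (simp add: p_def powr_def \<tau>_def)
    also have "\<dots> = exp (s * ln (r i) + codim * (t + ln (r i)))" by (rule exp_add[symmetric])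
    also have "s * ln (r i) + codim * (t + ln (r i)) = codim * t + real DIM('a) * ln (r i)"
      by (simp add: codim_def algebra_simps)
    also have "exp \<dots> = exp (codim * t) * r i ^ DIM('a)"
      unfolding exp_add exp_of_nat_mult using r by simp
    finally have 2: "p i * exp (codim * (t - \<tau> i)) = exp (codim * t) * r i ^ DIM('a)" .
    show ?thesis unfolding w_def 1 mult.assoc[symmetric] 2 ..
  qed
  then show ?thesis
    unfolding w_def[of t] z_def volume_renewal[OF null_F, of "exp (- t)"]
    by (simp add: distrib_left sum_distrib_left)
qed

lemma w_slowly_decreasing:
  assumes "x \<le> y" shows "w y \<le> exp (codim * (y - x)) * w x"
proof -
  have "w y \<le> exp (codim * y) * volume_in_U (exp (- x))"
    unfolding w_def using assms by (intro mult_left_mono volume_in_U_mono) auto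
  also have "exp (codim * y) = exp (codim * (y - x)) * exp (codim * x)"
    unfolding exp_add[symmetric] by (simp add: right_diff_distrib)
  also have "exp (codim * (y - x)) * exp (codim * x) * volume_in_U (exp (- x)) = exp (codim * (y - x)) * w x"
    by (simp add: w_def mult.assoc)
  finally show ?thesis .
qed

lemma w_bounded: obtains B where "\<And>t. w t \<le> B"
proof -
  obtain C where C: "0 \<le> C" "\<And>\<epsilon>. 0 < \<epsilon> \<Longrightarrow> \<epsilon> \<le> 1 \<Longrightarrow>
      measure lebesgue (parallel_set F \<epsilon>) \<le> C * \<epsilon> powr (real DIM('a) - s)"
    by (rule F_parallel_volume[OF s_sum]) blast
  have "w t \<le> max C (measure lebesgue U)" for t
  proof (cases "0 \<le> t")
    case True
    have "volume_in_U (exp (- t)) \<le> measure lebesgue (parallel_set F (exp (- t)))"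
      using parallel_volume_split[of "exp (- t)"] by simp
    also have "\<dots> \<le> C * exp (- t) powr (real DIM('a) - s)" using True by (intro C) auto
    also have "\<dots> = C * exp (- (codim * t))" by (simp add: powr_def codim_def)
    finally have "w t \<le> exp (codim * t) * (C * exp (- (codim * t)))"
      unfolding w_def by (intro mult_left_mono) auto
    also have "\<dots> = C" by (simp add: exp_minus)
    finally show ?thesis by simp
  next
    case False
    then have "codim * t \<le> 0" using codim_bounds by (simp add: mult_nonneg_nonpos)
    then have "w t \<le> 1 * volume_in_U (exp (- t))"
      unfolding w_def by (intro mult_right_mono volume_in_U_nonneg) auto
    then show ?thesis using volume_in_U_le[of "exp (- t)"] by simp
  qed
  with that show ?thesis by blast
qed

text \<open>A monophase generator has an inner parallel volume of order \<open>\<epsilon>\<close>, because its polynomial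
  has no constant term; as \<open>d - s < 1\<close>, this decays faster than \<open>\<epsilon> powr (d - s)\<close>.\<close>

lemma z_tendsto_0: "(z \<longlongrightarrow> 0) at_top"
proof -
  define c where "c = (\<Sum>k<DIM('a). \<bar>\<kappa> k\<bar>)"
  have "\<forall>\<^sub>F t in at_top. norm (z t) \<le> norm (exp (- ((1 - codim) * t))) * c"
    using eventually_ge_at_top[of "max 0 (- ln g)"]
  proof eventually_elim
    case (elim t)
    then have t: "0 \<le> t" "- t \<le> ln g" by auto
    from t(2) have "exp (- t) \<le> g" using g_pos by (simp add: ln_ge_iff)
    then have "inner_parallel_volume G (exp (- t)) = (\<Sum>k<DIM('a). \<kappa> k * exp (- t) ^ (DIM('a) - k))"
      by (intro inner_parallel_volume_G) auto
    also have "\<dots> \<le> (\<Sum>k<DIM('a). \<bar>\<kappa> k\<bar> * exp (- t))"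
    proof (rule sum_mono)
      fix k assume "k \<in> {..<DIM('a)}"
      then have "exp (- t) ^ (DIM('a) - k) \<le> exp (- t) ^ 1"
        using t by (intro power_decreasing) auto
      then show "\<kappa> k * exp (- t) ^ (DIM('a) - k) \<le> \<bar>\<kappa> k\<bar> * exp (- t)"
        by (intro mult_mono) auto
    qed
    also have "\<dots> = c * exp (- t)" by (simp add: c_def sum_distrib_right)
    finally have "z t \<le> exp (codim * t) * (c * exp (- t))"
      unfolding z_def by (intro mult_left_mono) auto
    also have "\<dots> = (exp (codim * t) * exp (- t)) * c" by simp
    also have "exp (codim * t) * exp (- t) = exp (- ((1 - codim) * t))"
      unfolding exp_add[symmetric] by (simp add: left_diff_distrib)
    finally show ?case using z_nonneg[of t] by simp
  qed
  moreover have "((\<lambda>t. exp (- ((1 - codim) * t))) \<longlongrightarrow> 0) at_top"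
  proof -
    have "filterlim (\<lambda>t. (1 - codim) * t) at_top at_top"
      using codim_bounds by (intro filterlim_tendsto_pos_mult_at_top[OF tendsto_const _ filterlim_ident]) auto
    then show ?thesis
      by (intro filterlim_compose[OF exp_at_bot]) (simp add: filterlim_uminus_at_top)
  qed
  ultimately show ?thesis by (rule tendsto_0_le[rotated])
qed

text \<open>The part of the parallel set outside \<open>U\<close> is asymptotically negligible, so the Minkowski
  content of \<open>F\<close> is the limit of the solution \<open>w\<close> of the renewal equation.\<close>

lemma w_limit_iff_content:
  "(w \<longlongrightarrow> L) at_top \<longleftrightarrow> has_minkowski_content F s L"
proof -
  define X where "X \<epsilon> = \<epsilon> powr (s - real DIM('a)) * measure lebesgue (parallel_set F \<epsilon> - U)" for \<epsilon>
  have eq: "\<epsilon> powr (s - real DIM('a)) * measure lebesgue (parallel_set F \<epsilon>) = w (- ln \<epsilon>) + X \<epsilon>"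
    if "0 < \<epsilon>" for \<epsilon>
    using that unfolding parallel_volume_split X_def w_def
    by (simp add: distrib_left powr_def codim_def algebra_simps)
  have X: "(X \<longlongrightarrow> 0) (at_right 0)"
  proof -
    obtain s' C where s': "s' < s" "0 \<le> C" "\<And>\<epsilon>. 0 < \<epsilon> \<Longrightarrow> \<epsilon> \<le> 1 \<Longrightarrow>
      measure lebesgue (parallel_set (frontier U) \<epsilon>) \<le> C * \<epsilon> powr (real DIM('a) - s')"
      by (rule frontier_U_parallel_volume[OF s_sum]) blast
    have "\<forall>\<^sub>F \<epsilon>::real in at_right 0. \<epsilon> \<in> {0<..<1}" by (rule eventually_at_right_real) simp
    then have "\<forall>\<^sub>F \<epsilon> in at_right 0. norm (X \<epsilon>) \<le> norm (\<epsilon> powr (s - s')) * C"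
    proof eventually_elim
      case (elim \<epsilon>)
      have fr: "compact (frontier U)" using bounded_U by (rule compact_frontier_bounded)
      have "measure lebesgue (parallel_set F \<epsilon> - U) \<le> measure lebesgue (parallel_set (frontier U) \<epsilon>)"
        using parallel_set_outside_subset lmeasurable_U
          parallel_set_lmeasurable[OF compact_F F_nonempty]
          parallel_set_lmeasurable[OF fr frontier_U_nonempty]
        by (intro measure_mono_fmeasurable) (auto dest: fmeasurableD)
      also have "\<dots> \<le> C * \<epsilon> powr (real DIM('a) - s')" using elim by (intro s') auto
      finally have "X \<epsilon> \<le> \<epsilon> powr (s - real DIM('a)) * (C * \<epsilon> powr (real DIM('a) - s'))"
        unfolding X_def by (intro mult_left_mono) auto
      also have "\<dots> = \<epsilon> powr (s - s') * C"
        using elim by (simp add: powr_add[symmetric] mult.left_commute mult.commute)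
      finally show ?case by (simp add: X_def)
    qed
    moreover have "((\<lambda>\<epsilon>. \<epsilon> powr (s - s')) \<longlongrightarrow> 0) (at_right 0)"
    proof -
      have "((\<lambda>\<epsilon>::real. \<epsilon> powr (s - s')) \<longlongrightarrow> 0 powr (s - s')) (at_right 0)"
        by (rule tendsto_powr') (use s' in \<open>auto simp: eventually_at_filter\<close>)
      then show ?thesis by simp
    qed
    ultimately show ?thesis by (rule tendsto_0_le[rotated])
  qed
  have "has_minkowski_content F s L \<longleftrightarrow> ((\<lambda>\<epsilon>. w (- ln \<epsilon>) + X \<epsilon>) \<longlongrightarrow> L) (at_right 0)"
    unfolding has_minkowski_content_def
    by (intro filterlim_cong refl) (auto simp: eventually_at_filter eq)
  also have "\<dots> \<longleftrightarrow> ((\<lambda>\<epsilon>. w (- ln \<epsilon>)) \<longlongrightarrow> L) (at_right 0)"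
  proof
    assume "((\<lambda>\<epsilon>. w (- ln \<epsilon>) + X \<epsilon>) \<longlongrightarrow> L) (at_right 0)"
    from tendsto_diff[OF this X] show "((\<lambda>\<epsilon>. w (- ln \<epsilon>)) \<longlongrightarrow> L) (at_right 0)" by simp
  next
    assume "((\<lambda>\<epsilon>. w (- ln \<epsilon>)) \<longlongrightarrow> L) (at_right 0)"
    from tendsto_add[OF this X] show "((\<lambda>\<epsilon>. w (- ln \<epsilon>) + X \<epsilon>) \<longlongrightarrow> L) (at_right 0)" by simp
  qed
  also have "\<dots> \<longleftrightarrow> (w \<longlongrightarrow> L) at_top"
  proof
    assume "((\<lambda>\<epsilon>. w (- ln \<epsilon>)) \<longlongrightarrow> L) (at_right 0)"
    moreover have "((\<lambda>t::real. exp (- t)) \<longlongrightarrow> 0) at_top"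
      by (rule filterlim_compose[OF exp_at_bot filterlim_uminus_at_bot_at_top])
    then have "filterlim (\<lambda>t::real. exp (- t)) (at_right 0) at_top"
      by (simp add: filterlim_at)
    ultimately have "((\<lambda>t. w (- ln (exp (- t)))) \<longlongrightarrow> L) at_top"
      by (rule filterlim_compose)
    then show "(w \<longlongrightarrow> L) at_top" by simp
  next
    assume "(w \<longlongrightarrow> L) at_top"
    then show "((\<lambda>\<epsilon>. w (- ln \<epsilon>)) \<longlongrightarrow> L) (at_right 0)"
      by (rule filterlim_compose) (rule filterlim_minus_ln_at_right_0)
  qed
  finally show ?thesis ..
qed

lemma group_closure_\<tau>: "group_closure (\<tau> ` {1..N}) = group_closure ((\<lambda>i. ln (r i)) ` {1..N})"
  using group_closure_uminus_image[of "(\<lambda>i. ln (r i)) ` {1..N}"]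
  by (simp add: image_image \<tau>_def[abs_def])

lemma nonlattice_imp_measurable:
  assumes "nonlattice N r" shows "minkowski_measurable F"
proof -
  obtain B where B: "\<And>t. w t \<le> B" by (rule w_bounded) blast
  have "\<exists>L>0. (w \<longlongrightarrow> L) at_top"
  proof (rule renewal_limit[of "{1..N}" p \<tau> w B codim])
    show "\<not> discrete (group_closure (\<tau> ` {1..N}))"
      using assms unfolding nonlattice_def group_closure_\<tau> .
    show "(\<Sum>i\<in>{1..N}. p i * w (t - \<tau> i)) \<le> w t" for t
      using w_renewal[of t] z_nonneg[of t] by linarith
    have "(\<lambda>t. w t - (\<Sum>i\<in>{1..N}. p i * w (t - \<tau> i))) = z"
    proof
      fix t show "w t - (\<Sum>i\<in>{1..N}. p i * w (t - \<tau> i)) = z t" using w_renewal[of t] by linarith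
    qed
    then show "((\<lambda>t. w t - (\<Sum>i\<in>{1..N}. p i * w (t - \<tau> i))) \<longlongrightarrow> 0) at_top"
      using z_tendsto_0 by simp
  qed (use p_pos p_sum \<tau>_pos w_pos B w_slowly_decreasing codim_bounds in auto)
  moreover have "0 \<le> s"
  proof -
    have "1 \<le> real DIM('a)" using DIM_positive[where 'a = 'a] by linarith
    then show ?thesis using s_lower by linarith
  qed
  ultimately show ?thesis
    using compact_F w_limit_iff_content
    by (auto simp: minkowski_measurable_def compact_imp_bounded)
qed

end

context monophase_ifs
begin

section \<open>The lattice case\<close>

text \<open>If all \<open>\<tau> i\<close> are multiples of \<open>h\<close>, the source term \<open>z\<close> is the increment of \<open>\<Psi>\<close> over a
  step of length \<open>h\<close>. Summing it along \<open>t, t + h, t + 2 * h, \<dots>\<close> shows that convergence of \<open>w\<close>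
  would make \<open>(\<Sum>n. z (t + n * h)) + \<Psi> (t - h)\<close> independent of \<open>t\<close>. Choose \<open>t\<close> with
  \<open>\<epsilon> = exp (- t)\<close> between \<open>g * exp (- h)\<close> and the inradius \<open>g\<close>. Then the sum consists of geometric series,
  one for each power of \<open>\<epsilon>\<close> in the monophase polynomial, and \<open>\<Psi> (t - h)\<close> is a positive multiple of
  \<open>\<epsilon> powr (- codim)\<close>, since the parallel set fills \<open>U\<close> at the scales involved. So a polynomial with
  positive constant term would agree on an interval with a multiple of \<open>\<epsilon> powr codim\<close>, where
  \<open>0 < codim < 1\<close>.\<close>

lemma lattice_imp_no_limit:
  assumes lattice: "\<not> nonlattice N r" and lim: "(w \<longlongrightarrow> M) at_top"
  shows False
proof -
  have disc: "discrete (group_closure (\<tau> ` {1..N}))"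
    using lattice unfolding nonlattice_def group_closure_\<tau> by simp
  have "(1::nat) \<in> {1..N}" using N_ge_2 by simp
  then have "\<tau> 1 \<in> \<tau> ` {1..N}" "\<tau> 1 \<noteq> 0" using \<tau>_pos[of 1] by auto
  from discrete_group_subset_multiples[OF disc this]
  obtain h where h: "0 < h" and mult: "\<And>x. x \<in> \<tau> ` {1..N} \<Longrightarrow> \<exists>k::int. x = of_int k * h"
    by blast
  have "\<exists>m::nat. 0 < m \<and> \<tau> i = real m * h" if i: "i \<in> {1..N}" for i
  proof -
    obtain k :: int where k: "\<tau> i = of_int k * h" using mult i by blast
    then have "0 < of_int k * h" using \<tau>_pos[OF i] by simp
    then have "0 < k" using h by (simp add: zero_less_mult_iff)
    then show ?thesis using k by (intro exI[of _ "nat k"]) simp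
  qed
  then obtain m :: "nat \<Rightarrow> nat" where m: "\<And>i. i \<in> {1..N} \<Longrightarrow> 0 < m i"
    "\<And>i. i \<in> {1..N} \<Longrightarrow> \<tau> i = real (m i) * h" by metis

  define \<Psi> where "\<Psi> t = (\<Sum>i\<in>{1..N}. p i * (\<Sum>j<m i. w (t - real j * h)))" for t
  have step: "\<Psi> t - \<Psi> (t - h) = z t" for t
  proof -
    have tel: "(\<Sum>j<m i. w (t - real j * h)) - (\<Sum>j<m i. w (t - h - real j * h)) = w t - w (t - \<tau> i)"
      if "i \<in> {1..N}" for i
    proof -
      have "(\<Sum>j<m i. w (t - real j * h) - w (t - real (Suc j) * h)) =
          w (t - real 0 * h) - w (t - real (m i) * h)"
        by (rule sum_lessThan_telescope')
      moreover have "t - real (Suc j) * h = t - h - real j * h" for j by (simp add: algebra_simps)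
      ultimately show ?thesis using m(2)[OF that] by (simp only: sum_subtractf) simp
    qed
    have "\<Psi> t - \<Psi> (t - h) = (\<Sum>i\<in>{1..N}. p i *
        ((\<Sum>j<m i. w (t - real j * h)) - (\<Sum>j<m i. w (t - h - real j * h))))"
      unfolding \<Psi>_def sum_subtractf[symmetric] right_diff_distrib[symmetric] ..
    also have "\<dots> = (\<Sum>i\<in>{1..N}. p i * (w t - w (t - \<tau> i)))" using tel by simp
    also have "\<dots> = (\<Sum>i\<in>{1..N}. p i) * w t - (\<Sum>i\<in>{1..N}. p i * w (t - \<tau> i))"
      by (simp add: right_diff_distrib sum_subtractf sum_distrib_right)
    finally show ?thesis using w_renewal[of t] p_sum by simp
  qed
  have sum_z: "(\<Sum>n<K. z (t + real n * h)) = \<Psi> (t - h + real K * h) - \<Psi> (t - h)" for K t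
  proof (induction K)
    case (Suc K)
    have "\<Psi> (t + real K * h) - \<Psi> (t - h + real K * h) = z (t + real K * h)"
      using step[of "t + real K * h"] by (simp add: algebra_simps)
    moreover have eq: "t - h + real (Suc K) * h = t + real K * h" by (simp add: algebra_simps)
    ultimately show ?case using Suc unfolding eq by simp
  qed simp
  define Q where "Q = (\<Sum>i\<in>{1..N}. p i * (\<Sum>j<m i. M))"
  have \<Psi>_lim: "(\<Psi> \<longlongrightarrow> Q) at_top"
    unfolding \<Psi>_def[abs_def] Q_def
  proof (intro tendsto_sum tendsto_mult tendsto_const)
    fix j
    have "filterlim (\<lambda>t::real. - (real j * h) + t) at_top at_top"
      by (intro filterlim_tendsto_add_at_top[OF tendsto_const] filterlim_ident)
    then have "((\<lambda>t. w (- (real j * h) + t)) \<longlongrightarrow> M) at_top" by (rule filterlim_compose[OF lim])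
    then show "((\<lambda>t. w (t - real j * h)) \<longlongrightarrow> M) at_top" by simp
  qed
  have z_sums: "(\<lambda>n. z (t + real n * h)) sums (Q - \<Psi> (t - h))" for t
  proof -
    have "filterlim (\<lambda>K. real K * h) at_top sequentially"
      using filterlim_tendsto_pos_mult_at_top[OF tendsto_const h filterlim_real_sequentially]
      by (simp add: mult.commute)
    then have "filterlim (\<lambda>K. (t - h) + real K * h) at_top sequentially"
      by (rule filterlim_tendsto_add_at_top[OF tendsto_const])
    then have "(\<lambda>K. \<Psi> (t - h + real K * h)) \<longlonglongrightarrow> Q" by (rule filterlim_compose[OF \<Psi>_lim])
    then have "(\<lambda>K. \<Psi> (t - h + real K * h) - \<Psi> (t - h)) \<longlonglongrightarrow> Q - \<Psi> (t - h)"
      by (intro tendsto_diff tendsto_const)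
    then show ?thesis unfolding sums_def sum_z .
  qed

  define b where "b k = exp ((codim - real (DIM('a) - k)) * h)" for k
  have b: "0 < b k" "b k < 1" if "k < DIM('a)" for k
  proof -
    have "1 \<le> real (DIM('a) - k)" using that by simp
    then have "codim - real (DIM('a) - k) < 0" using codim_bounds by linarith
    then show "b k < 1" using h by (simp add: b_def mult_neg_pos)
  qed (simp add: b_def)
  define c where "c = measure lebesgue U * (\<Sum>i\<in>{1..N}. p i * (\<Sum>j<m i. exp (- (codim * (real (Suc j) * h)))))"
  have "0 < (\<Sum>i\<in>{1..N}. p i * (\<Sum>j<m i. exp (- (codim * (real (Suc j) * h)))))"
  proof (rule sum_pos)
    fix i assume i: "i \<in> {1..N}"
    have "0 < (\<Sum>j<m i. exp (- (codim * (real (Suc j) * h))))"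
      using m(1)[OF i] by (intro sum_pos) (auto simp: lessThan_empty_iff)
    then show "0 < p i * (\<Sum>j<m i. exp (- (codim * (real (Suc j) * h))))" using p_pos[OF i] by simp
  qed (use N_ge_2 in auto)
  then have c: "0 < c" using measure_U_pos by (simp add: c_def)
  define P where "P = [:c:] + (\<Sum>k<DIM('a). monom (\<kappa> k / (1 - b k)) (DIM('a) - k))"
  have "poly P \<epsilon> = Q * \<epsilon> powr codim" if \<epsilon>: "\<epsilon> \<in> {g * exp (- h)<..<g}" for \<epsilon>
  proof -
    have "0 < g * exp (- h)" using g_pos by simp
    then have \<epsilon>0: "0 < \<epsilon>" "\<epsilon> < g" "g * exp (- h) < \<epsilon>" using \<epsilon> by auto
    define t where "t = - ln \<epsilon>"
    have et: "exp (- t) = \<epsilon>" "exp (codim * t) * \<epsilon> powr codim = 1"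
      using \<epsilon>0 by (simp_all add: t_def powr_def exp_minus)
    have z_eq: "z (t + real n * h) = exp (codim * t) * (\<Sum>k<DIM('a). \<kappa> k * \<epsilon> ^ (DIM('a) - k) * b k ^ n)" for n
    proof -
      define y where "y = exp (- (real n * h))"
      have y: "0 < y" "y \<le> 1" using h by (auto simp: y_def)
      have e: "exp (- (t + real n * h)) = \<epsilon> * y"
        unfolding et(1)[symmetric] y_def exp_add[symmetric] by simp
      have "\<epsilon> * y \<le> g" using y \<epsilon>0 mult_left_le[of y \<epsilon>] by linarith
      then have V: "inner_parallel_volume G (\<epsilon> * y) = (\<Sum>k<DIM('a). \<kappa> k * (\<epsilon> * y) ^ (DIM('a) - k))"
        using \<epsilon>0 y by (intro inner_parallel_volume_G) auto
      have b_n: "exp (codim * (real n * h)) * y ^ (DIM('a) - k) = b k ^ n" for k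
        unfolding y_def b_def exp_of_nat_mult[symmetric] exp_add[symmetric]
        by (rule arg_cong[where f = exp]) (simp add: algebra_simps)
      have "exp (codim * (t + real n * h)) = exp (codim * t) * exp (codim * (real n * h))"
        by (simp add: distrib_left exp_add)
      then have "z (t + real n * h) = exp (codim * t) *
          (\<Sum>k<DIM('a). \<kappa> k * \<epsilon> ^ (DIM('a) - k) * (exp (codim * (real n * h)) * y ^ (DIM('a) - k)))"
        unfolding z_def e V by (simp add: sum_distrib_left power_mult_distrib mult_ac)
      then show ?thesis unfolding b_n .
    qed
    have "(\<lambda>n. z (t + real n * h)) sums
        (exp (codim * t) * (\<Sum>k<DIM('a). \<kappa> k * \<epsilon> ^ (DIM('a) - k) * (1 / (1 - b k))))"
      unfolding z_eq using b by (intro sums_mult sums_sum geometric_sums) (auto simp: abs_of_pos)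
    then have 1: "exp (codim * t) * (\<Sum>k<DIM('a). \<kappa> k * \<epsilon> ^ (DIM('a) - k) * (1 / (1 - b k))) =
        Q - \<Psi> (t - h)"
      using z_sums by (rule sums_unique2)
    have 2: "\<Psi> (t - h) = exp (codim * t) * c"
    proof -
      have "w (t - h - real j * h) = exp (codim * t) * (measure lebesgue U * exp (- (codim * (real (Suc j) * h))))"
        for j
      proof -
        have "g \<le> exp (- (t - h - real j * h))"
        proof -
          have "g = g * exp (- h) * exp h" by (simp add: exp_minus)
          also have "\<dots> \<le> exp (- t) * exp h" using \<epsilon>0 et by simp
          also have "\<dots> \<le> exp (- t) * exp (h + real j * h)" using h by simp
          also have "\<dots> = exp (- (t - h - real j * h))" unfolding exp_add[symmetric] by (simp add: algebra_simps)
          finally show ?thesis .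
        qed
        moreover have "exp (codim * (t - h - real j * h)) = exp (codim * t) * exp (- (codim * (real (Suc j) * h)))"
          unfolding exp_add[symmetric] by (simp add: algebra_simps)
        ultimately show ?thesis unfolding w_def by (simp add: volume_in_U_eq_measure_U)
      qed
      then show ?thesis
        unfolding \<Psi>_def c_def by (simp add: sum_distrib_left mult_ac)
    qed
    have "poly P \<epsilon> = c + (\<Sum>k<DIM('a). \<kappa> k * \<epsilon> ^ (DIM('a) - k) * (1 / (1 - b k)))"
      by (simp add: P_def poly_sum poly_monom)
    also have "\<dots> = (exp (codim * t) * \<epsilon> powr codim) * \<dots>" using et by simp
    also have "\<dots> = \<epsilon> powr codim * (exp (codim * t) * c +
        exp (codim * t) * (\<Sum>k<DIM('a). \<kappa> k * \<epsilon> ^ (DIM('a) - k) * (1 / (1 - b k))))"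
      by (simp only: distrib_left mult_ac)
    also have "\<dots> = \<epsilon> powr codim * Q" unfolding 1 2 by simp
    finally show ?thesis by (simp add: mult.commute)
  qed
  moreover have "0 \<le> g * exp (- h)" "g * exp (- h) < g" using g_pos h by auto
  ultimately have "P = 0"
    using codim_bounds by (intro poly_eq_fractional_power_imp_zero)
  moreover have "coeff P 0 = c"
    by (simp add: P_def coeff_sum)
  ultimately show False using c by simp
qed

text \<open>A content with another exponent \<open>s'\<close> reduces to the exponent \<open>s\<close>: if \<open>s' < s\<close>, it makes the
  \<open>s\<close>-dimensional content zero, so \<open>w\<close> converges to \<open>0\<close>; if \<open>s' > s\<close>, the upper bound for the
  parallel volume makes it vanish.\<close>

lemma measurable_imp_nonlattice:
  assumes "minkowski_measurable F" shows "nonlattice N r"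
proof (rule ccontr)
  assume lattice: "\<not> nonlattice N r"
  obtain s' M where M: "0 < M" "has_minkowski_content F s' M"
    using assms by (auto simp: minkowski_measurable_def)
  define T where "T \<sigma> \<epsilon> = \<epsilon> powr (\<sigma> - real DIM('a)) * measure lebesgue (parallel_set F \<epsilon>)" for \<sigma> \<epsilon>
  have T_lim: "(T s' \<longlongrightarrow> M) (at_right 0)"
    using M(2) by (simp add: has_minkowski_content_def T_def[abs_def])
  have T_shift: "T \<sigma> \<epsilon> = \<epsilon> powr (\<sigma> - \<rho>) * T \<rho> \<epsilon>" if "0 < \<epsilon>" for \<sigma> \<rho> \<epsilon>
    using that by (simp add: T_def mult.assoc[symmetric] powr_add[symmetric])
  have powr_0: "((\<lambda>\<epsilon>::real. \<epsilon> powr e) \<longlongrightarrow> 0) (at_right 0)" if "0 < e" for e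
  proof -
    have "((\<lambda>\<epsilon>::real. \<epsilon> powr e) \<longlongrightarrow> 0 powr e) (at_right 0)"
      by (rule tendsto_powr') (use that in \<open>auto simp: eventually_at_filter\<close>)
    then show ?thesis by simp
  qed
  consider "s' = s" | "s' < s" | "s < s'" by linarith
  then show False
  proof cases
    case 1
    then show False
      using lattice_imp_no_limit[OF lattice] M(2) w_limit_iff_content by blast
  next
    case 2
    have "((\<lambda>\<epsilon>. \<epsilon> powr (s - s') * T s' \<epsilon>) \<longlongrightarrow> 0 * M) (at_right 0)"
      using 2 by (intro tendsto_mult powr_0 T_lim) simp
    moreover have "\<forall>\<^sub>F \<epsilon> in at_right 0. \<epsilon> powr (s - s') * T s' \<epsilon> = T s \<epsilon>"
      by (auto simp: eventually_at_filter T_shift[of _ s s'])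
    ultimately have "(T s \<longlongrightarrow> 0 * M) (at_right 0)" by (rule Lim_transform_eventually)
    then have "has_minkowski_content F s 0"
      by (simp add: has_minkowski_content_def T_def[abs_def])
    then show False using lattice_imp_no_limit[OF lattice] w_limit_iff_content by blast
  next
    case 3
    obtain C where C: "0 \<le> C" "\<And>\<epsilon>. 0 < \<epsilon> \<Longrightarrow> \<epsilon> \<le> 1 \<Longrightarrow>
      measure lebesgue (parallel_set F \<epsilon>) \<le> C * \<epsilon> powr (real DIM('a) - s)"
      by (rule F_parallel_volume[OF s_sum]) blast
    have "\<forall>\<^sub>F \<epsilon>::real in at_right 0. \<epsilon> \<in> {0<..<1}" by (rule eventually_at_right_real) simp
    then have "\<forall>\<^sub>F \<epsilon> in at_right 0. norm (T s' \<epsilon>) \<le> norm (\<epsilon> powr (s' - s)) * C"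
    proof eventually_elim
      case (elim \<epsilon>)
      have "T s' \<epsilon> \<le> \<epsilon> powr (s' - real DIM('a)) * (C * \<epsilon> powr (real DIM('a) - s))"
        unfolding T_def using C elim by (intro mult_left_mono) auto
      also have "\<dots> = (\<epsilon> powr (s' - real DIM('a)) * \<epsilon> powr (real DIM('a) - s)) * C" by simp
      also have "\<epsilon> powr (s' - real DIM('a)) * \<epsilon> powr (real DIM('a) - s) = \<epsilon> powr (s' - s)"
        unfolding powr_add[symmetric] by simp
      finally show ?case by (simp add: T_def)
    qed
    then have "(T s' \<longlongrightarrow> 0) (at_right 0)" using 3 by (intro tendsto_0_le[OF powr_0]) auto
    then have "M = 0" by (rule tendsto_unique[OF trivial_limit_at_right_real T_lim])
    then show False using M by simp
  qed
qed

end

theorem corollary3p11: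
  fixes N :: nat
    and S :: "nat \<Rightarrow> 'a::euclidean_space \<Rightarrow> 'a"
    and r :: "nat \<Rightarrow> real"
    and F :: "'a set"
    and D :: real
  assumes "similarity_ifs N S r"
    and "self_similar_set N S F"
    and "open_set_condition N S"
    and "has_minkowski_dimension F D"
    and "real DIM('a) - 1 < D" and "D < real DIM('a)"
    and "\<exists>U. strong_feasible_open_set N S F U \<and> frontier U \<subseteq> F \<and> monophase (generator N S U)"
  shows "minkowski_measurable F \<longleftrightarrow> nonlattice N r"
proof -
  obtain U where U: "strong_feasible_open_set N S F U" "frontier U \<subseteq> F"
    "monophase (generator N S U)"
    using assms(7) by blast
  interpret compatible_ifs N S r F U
    using assms(1,2) U by unfold_locales
  obtain s where s: "0 \<le> s" "s \<le> real DIM('a)" "(\<Sum>i\<in>{1..N}. r i powr s) = 1"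
    by (rule similarity_dimension_exists)
  note bounds = similarity_dimension_bounds[OF assms(4,6) s(2,3)]
  interpret monophase_ifs N S r F U s
    using s(3) bounds assms(5) U(3) by unfold_locales auto
  show ?thesis using nonlattice_imp_measurable measurable_imp_nonlattice by blast
qed

end
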